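(* Let $A\ge0$ be a random variable, $A\not\equiv1$, let $\kappa>0$, and assume: (1) $\theta:=\mathbf{E}A^\kappa<1$ (and $\theta>0$); (2) $F_\kappa\in\mathcal{S}_{loc}$; (3) with $\Delta=(0,1]$, $\sup_{y>x}F_\kappa(y+\Delta)=O(F_\kappa(x+\Delta))$ for $x$ large enough, i.e. there are constants $K,x_0$ with $\sup_{y>x}F_\kappa(y+\Delta)\le K F_\kappa(x+\Delta)$ for all $x\ge x_0$; (4) the law of $\log A$ conditioned on $A\ne0$ is nonarithmetic. Let $\log A_1,\log A_2,\ldots$ be independent copies of $\log A$, $S_n=\log A_1+\cdots+\log A_n$, and $M=\max\{0,S_1,S_2,\ldots\}$. Then there is a constant $c>0$ such that $$\mathbf{P}\{M>x\}\sim c\,g(x)\,e^{-\kappa x}\qquad(x\to\infty),$$ where $g(x)=F_\kappa(x+1)-F_\kappa(x)$.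
   Context: Convention: $\log0=-\infty$. $F_\kappa$ is the probability distribution function $F_\kappa(x)=\theta^{-1}\mathbf{E}[I(\log A\le x)A^\kappa]$, $x\in\mathbb{R}$, where $\theta=\mathbf{E}A^\kappa$. For $T\in(0,\infty)$ let $\Delta=(0,T]$, and for a distribution function $H$ on $\mathbb{R}$ put $H(x+\Delta)=H(x+T)-H(x)$. $H\in\mathcal{L}_\Delta$ if $H(x+t+\Delta)/H(x+\Delta)\to1$ as $x\to\infty$ uniformly in $t\in[0,1]$. $H\in\mathcal{S}_\Delta$ ($\Delta$-subexponential) if $H(x+\Delta)>0$ for all $x$ large enough, $H\in\mathcal{L}_\Delta$, and $(H*H)(x+\Delta)\sim2H(x+\Delta)$ as $x\to\infty$. $H\in\mathcal{S}_{loc}$ (locally subexponential) if $H\in\mathcal{S}_\Delta$ for every $T>0$. *)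

theory Defs
  imports "HOL-Probability.Probability" "HOL-Library.Landau_Symbols"
begin

(* The library's real ln is total, so the convention log 0 = -\<infinity> is made explicit. The argument
   is almost surely nonnegative wherever this is used; the value at negative reals plays no role. *)
definition elog :: "real \<Rightarrow> ereal" where
  "elog a = (if a \<le> 0 then - \<infinity> else ereal (ln a))"

definition distribution_function :: "(real \<Rightarrow> real) \<Rightarrow> bool" where
  "distribution_function H \<longleftrightarrow> (\<exists>\<mu>. real_distribution \<mu> \<and> H = cdf \<mu>)"

(* H (x + \<Delta>) for \<Delta> = (0, T] *)
definition incr :: "real \<Rightarrow> (real \<Rightarrow> real) \<Rightarrow> real \<Rightarrow> real" where
  "incr T H x = H (x + T) - H x"

(* H * H. For a distribution function H, interval_measure H is the law with cdf H. *)
definition self_convolution :: "(real \<Rightarrow> real) \<Rightarrow> real \<Rightarrow> real" where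
  "self_convolution H = cdf (interval_measure H \<star> interval_measure H)"

definition delta_long_tailed :: "real \<Rightarrow> (real \<Rightarrow> real) \<Rightarrow> bool" where
  "delta_long_tailed T H \<longleftrightarrow> distribution_function H \<and>
     uniform_limit {0..1} (\<lambda>x t. incr T H (x + t) / incr T H x) (\<lambda>_. 1) at_top"

definition delta_subexponential :: "real \<Rightarrow> (real \<Rightarrow> real) \<Rightarrow> bool" where
  "delta_subexponential T H \<longleftrightarrow>
     (\<forall>\<^sub>F x in at_top. incr T H x > 0) \<and>
     delta_long_tailed T H \<and>
     incr T (self_convolution H) \<sim>[at_top] (\<lambda>x. 2 * incr T H x)"

definition locally_subexponential :: "(real \<Rightarrow> real) \<Rightarrow> bool" where
  "locally_subexponential H \<longleftrightarrow> (\<forall>T>0. delta_subexponential T H)"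

definition moment :: "'a measure \<Rightarrow> ('a \<Rightarrow> real) \<Rightarrow> real \<Rightarrow> real" where
  "moment M A \<kappa> = (LINT \<omega>|M. A \<omega> powr \<kappa>)"

definition tilted_cdf :: "'a measure \<Rightarrow> ('a \<Rightarrow> real) \<Rightarrow> real \<Rightarrow> real \<Rightarrow> real" where
  "tilted_cdf M A \<kappa> x =
     inverse (moment M A \<kappa>) * (LINT \<omega>|M. indicator {\<omega>. elog (A \<omega>) \<le> ereal x} \<omega> * A \<omega> powr \<kappa>)"

(* A law on the reals is arithmetic if it is concentrated on d\<int> for some d > 0. *)
definition nonarithmetic :: "real measure \<Rightarrow> bool" where
  "nonarithmetic \<mu> \<longleftrightarrow> \<not> (\<exists>d>0. AE x in \<mu>. \<exists>k::int. x = d * of_int k)"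

definition log_law_given_nonzero :: "'a measure \<Rightarrow> ('a \<Rightarrow> real) \<Rightarrow> real measure" where
  "log_law_given_nonzero M A =
     distr (uniform_measure M {\<omega> \<in> space M. A \<omega> \<noteq> 0}) borel (\<lambda>\<omega>. ln (A \<omega>))"

definition log_walk :: "(nat \<Rightarrow> 'a \<Rightarrow> real) \<Rightarrow> nat \<Rightarrow> 'a \<Rightarrow> ereal" where
  "log_walk As n \<omega> = (\<Sum>i=1..n. elog (As i \<omega>))"

definition walk_max :: "(nat \<Rightarrow> 'a \<Rightarrow> real) \<Rightarrow> 'a \<Rightarrow> ereal" where
  "walk_max As \<omega> = max 0 (SUP n\<in>{1..}. log_walk As n \<omega>)"

end

theory Submission
  imports Defs
begin

text \<open>
  Let \<open>\<nu>\<close> be the law with distribution function \<open>F\<^sub>\<kappa>\<close>, and \<open>f x = e\<^sup>\<kappa>\<^sup>x P (M > x)\<close>. The maximum of the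
  walk satisfies \<open>M = max 0 (log A + M')\<close> with a copy \<open>M'\<close> of \<open>M\<close> independent of \<open>A\<close>, which after tilting
  reads \<open>f x = \<theta> \<integral> f (x - y) \<nu>(dy)\<close> for \<open>x \<ge> 0\<close>. For a large constant \<open>h\<close>, the jumps \<open>y \<le> h\<close> contribute
  about \<open>f x\<close> to this integral, the jumps \<open>y > x - h\<close> contribute about \<open>g x\<close> times the integral of \<open>f\<close>
  over \<open>(-\<infinity>, h)\<close>, and by subexponentiality the jumps in between contribute \<open>o(g x)\<close>, once \<open>f = O(g)\<close> is
  known from a Kesten-type bound. Hence the upper and lower limits of \<open>f / g\<close> both solve
  \<open>r = \<theta> (r + L)\<close>, where \<open>L\<close> is the integral of \<open>f\<close> over the line.
\<close>

subsection \<open>Local asymptotics of a locally subexponential law\<close>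

lemma Fubini_bounded:
  fixes f :: "'a \<Rightarrow> 'b \<Rightarrow> real"
  assumes "prob_space M" "prob_space N"
    and f: "case_prod f \<in> borel_measurable (M \<Otimes>\<^sub>M N)" and B: "\<And>x y. \<bar>f x y\<bar> \<le> B"
  shows "(\<integral>x. (\<integral>y. f x y \<partial>N) \<partial>M) = (\<integral>y. (\<integral>x. f x y \<partial>M) \<partial>N)"
proof -
  interpret M: prob_space M by fact
  interpret N: prob_space N by fact
  interpret P: pair_prob_space M N ..
  have "integrable (M \<Otimes>\<^sub>M N) (case_prod f)"
    using f B by (intro P.integrable_const_bound[where B=B]) auto
  then show ?thesis
    by (rule P.Fubini_integral[symmetric])
qed

lemma integrable_indicator_mult:
  fixes f :: "'a \<Rightarrow> real"
  assumes "integrable M f" "S \<in> sets M"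
  shows "integrable M (\<lambda>x. indicator S x * f x)"
  using integrable_mult_indicator[of S M f] assms by simp

lemma filterlim_add_const_at_top: "filterlim (\<lambda>x. x + c :: real) at_top at_top"
  using filterlim_tendsto_add_at_top[OF tendsto_const[of c] filterlim_ident]
  by (subst add.commute)

lemma exponential_mean:
  assumes \<kappa>: "\<kappa> > 0"
  shows "integrable lborel (\<lambda>s. exponential_density \<kappa> s * s)"
    and "integrable lborel (exponential_density \<kappa>)"
    and "(\<integral>s. exponential_density \<kappa> s * s \<partial>lborel) = 1 / \<kappa>"
proof -
  define E where "E = density lborel (exponential_density \<kappa>)"
  interpret E: prob_space E unfolding E_def by (rule prob_space_exponential_density[OF \<kappa>])
  have D: "distributed E lborel (\<lambda>s. s) (exponential_density \<kappa>)"
    unfolding distributed_def using distr_id[of lborel]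
    by (auto simp: E_def distr_id2)
  have "E.expectation (\<lambda>s. s) = 1 / \<kappa>"
    by (rule E.exponential_distributed_expectation[OF \<kappa> D])
  then show m: "(\<integral>s. exponential_density \<kappa> s * s \<partial>lborel) = 1 / \<kappa>"
    unfolding E_def using \<kappa> by (subst (asm) integral_density) (auto simp: exponential_density_nonneg)
  \<comment> \<open>A non-integrable function has Bochner integral 0, whereas this one has integral
    \<open>1 / \<kappa> > 0\<close>.\<close>
  show "integrable lborel (\<lambda>s. exponential_density \<kappa> s * s)"
    using m \<kappa> by (rule_tac ccontr) (simp add: not_integrable_integral_eq)
  show "integrable lborel (exponential_density \<kappa>)"
    using distributed_integrable[OF D, of "\<lambda>_. 1"] \<kappa> by (simp add: exponential_density_nonneg)
qed

lemma (in real_distribution) borel_measurable_cdf [measurable]: "cdf M \<in> borel_measurable borel"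
  by (rule borel_measurable_mono) (simp add: mono_def cdf_nondecreasing)

text \<open>The hypotheses on \<open>F\<^sub>\<kappa>\<close> in working form: shifts are taken
  pointwise in \<open>t\<close>, the convolution is an integral, and the domination includes
  \<open>y = x\<close>.\<close>

locale dominated_subexponential = real_distribution +
  fixes K x0 :: real
  assumes incr_pos: "T > 0 \<Longrightarrow> \<forall>\<^sub>F x in at_top. incr T (cdf M) x > 0"
    and incr_shift: "T > 0 \<Longrightarrow> t \<in> {0..1} \<Longrightarrow>
      ((\<lambda>x. incr T (cdf M) (x + t) / incr T (cdf M) x) \<longlongrightarrow> 1) at_top"
    and convolution_limit:
      "((\<lambda>x. (\<integral>y. incr 1 (cdf M) (x - y) \<partial>M) / incr 1 (cdf M) x) \<longlongrightarrow> 2) at_top"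
    and local_pos: "x \<ge> x0 \<Longrightarrow> incr 1 (cdf M) x > 0"
    and local_dom: "x \<ge> x0 \<Longrightarrow> y \<ge> x \<Longrightarrow> incr 1 (cdf M) y \<le> K * incr 1 (cdf M) x"
begin

declare events_eq_borel [measurable_cong]

abbreviation g :: "real \<Rightarrow> real" where "g \<equiv> incr 1 (cdf M)"

section \<open>Increments of arbitrary length against unit increments\<close>

lemma K_ge_1: "K \<ge> 1"
  using local_dom[of x0 x0] local_pos[of x0] by simp

lemma borel_measurable_incr [measurable]: "incr s (cdf M) \<in> borel_measurable borel"
  unfolding incr_def[abs_def] by measurable

lemma incr_eq_measure: "0 \<le> s \<Longrightarrow> incr s (cdf M) x = measure M {x<..x + s}"
  by (cases "s = 0") (auto simp: incr_def cdf_diff_eq)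

lemma incr_nonneg: "0 \<le> s \<Longrightarrow> 0 \<le> incr s (cdf M) x"
  by (simp add: incr_eq_measure)

lemma incr_le_1: "0 \<le> s \<Longrightarrow> incr s (cdf M) x \<le> 1"
  by (simp add: incr_eq_measure)

lemma incr_mono: "s \<le> t \<Longrightarrow> incr s (cdf M) x \<le> incr t (cdf M) x"
  by (simp add: incr_def cdf_nondecreasing)

lemma incr_of_nat_mult: "incr (real n * T) (cdf M) x = (\<Sum>j<n. incr T (cdf M) (x + real j * T))"
  by (induction n) (auto simp: incr_def algebra_simps)

lemma g_eventually_pos: "\<forall>\<^sub>F x in at_top. g x > 0"
  using eventually_ge_at_top[of x0] by eventually_elim (rule local_pos)

text \<open>A shift by \<open>j * T\<close> factors into \<open>j\<close> shifts by
  \<open>T\<close>; the locale controls only shifts in \<open>{0..1}\<close>, hence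
  \<open>T \<le> 1\<close>.\<close>

lemma incr_shift_nat:
  assumes "0 < T" "T \<le> 1"
  shows "((\<lambda>x. incr T (cdf M) (x + real j * T) / incr T (cdf M) x) \<longlongrightarrow> 1) at_top"
proof (induction j)
  case 0
  show ?case
    by (rule tendsto_eventually) (use incr_pos[OF assms(1)] in \<open>auto elim: eventually_mono\<close>)
next
  case (Suc j)
  let ?d = "incr T (cdf M)"
  have lim: "filterlim (\<lambda>x. x + real j * T) at_top at_top"
    by (rule filterlim_add_const_at_top)
  have "((\<lambda>x. ?d (x + real j * T + T) / ?d (x + real j * T)) \<longlongrightarrow> 1) at_top"
    using filterlim_compose[OF incr_shift[OF assms(1), of T] lim] assms by simp
  from tendsto_mult[OF this Suc.IH]
  have "((\<lambda>x. ?d (x + real j * T + T) / ?d (x + real j * T) * (?d (x + real j * T) / ?d x)) \<longlongrightarrow> 1) at_top"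
    by simp
  then show ?case
  proof (rule Lim_transform_eventually)
    have "\<forall>\<^sub>F x in at_top. ?d (x + real j * T) > 0"
      using lim[unfolded filterlim_iff] incr_pos[OF assms(1)] by blast
    then show "\<forall>\<^sub>F x in at_top. ?d (x + real j * T + T) / ?d (x + real j * T) * (?d (x + real j * T) / ?d x)
        = ?d (x + real (Suc j) * T) / ?d x"
      by eventually_elim (simp add: algebra_simps)
  qed
qed

text \<open>Intervals of lengths \<open>p / q\<close> and \<open>1\<close> consist of
  \<open>p\<close> and \<open>q\<close> pieces of length \<open>1 / q\<close>, and all these pieces
  have asymptotically equal mass.\<close>

lemma incr_ratio_rational:
  assumes "q \<ge> 1"
  shows "((\<lambda>x. incr (real p / real q) (cdf M) x / g x) \<longlongrightarrow> real p / real q) at_top"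
proof -
  define T where "T = 1 / real q"
  have T: "0 < T" "T \<le> 1" using assms by (auto simp: T_def)
  let ?d = "incr T (cdf M)"
  have *: "((\<lambda>x. incr (real n * T) (cdf M) x / ?d x) \<longlongrightarrow> real n) at_top" for n
    using tendsto_sum[where I="{..<n}", OF incr_shift_nat[OF T]]
    by (simp add: incr_of_nat_mult sum_divide_distrib)
  have "((\<lambda>x. (incr (real p * T) (cdf M) x / ?d x) / (incr (real q * T) (cdf M) x / ?d x)) \<longlongrightarrow> real p / real q) at_top"
    using assms by (intro tendsto_divide *) auto
  then show ?thesis
  proof (rule Lim_transform_eventually)
    show "\<forall>\<^sub>F x in at_top. (incr (real p * T) (cdf M) x / ?d x) / (incr (real q * T) (cdf M) x / ?d x)
        = incr (real p / real q) (cdf M) x / g x"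
      using incr_pos[OF T(1)] by eventually_elim (use assms in \<open>simp add: T_def\<close>)
  qed
qed

text \<open>Increments are monotone in their length, so \<open>s\<close> is squeezed between
  fractions \<open>p / q\<close> rounded down and up, with \<open>q\<close> so large that the mesh
  \<open>1 / q\<close> is finer than the gap between \<open>s\<close> and \<open>a\<close>.\<close>

lemma incr_ratio:
  assumes "0 \<le> s"
  shows "((\<lambda>x. incr s (cdf M) x / g x) \<longlongrightarrow> s) at_top"
proof (rule order_tendstoI)
  fix a assume "a < s"
  obtain q :: nat where q: "1 / (s - a) < real q" using reals_Archimedean2 by blast
  have q1: "q \<ge> 1" using q \<open>a < s\<close> by (cases q) (auto simp: field_simps)
  define p where "p = nat \<lfloor>real q * s\<rfloor>"
  have p: "real p \<le> real q * s" "real q * s < real p + 1"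
    using assms by (simp_all add: p_def)
  have *: "a < real p / real q" "real p / real q \<le> s"
    using q q1 p \<open>a < s\<close> by (auto simp: field_simps)
  show "\<forall>\<^sub>F x in at_top. a < incr s (cdf M) x / g x"
    using order_tendstoD(1)[OF incr_ratio_rational[OF q1] *(1)] g_eventually_pos
  proof eventually_elim
    case (elim x)
    have "incr (real p / real q) (cdf M) x / g x \<le> incr s (cdf M) x / g x"
      using elim * by (intro divide_right_mono incr_mono) auto
    with elim show ?case by linarith
  qed
next
  fix a assume "s < a"
  obtain q :: nat where q: "1 / (a - s) < real q" using reals_Archimedean2 by blast
  have q1: "q \<ge> 1" using q \<open>s < a\<close> by (cases q) (auto simp: field_simps)
  define p where "p = Suc (nat \<lfloor>real q * s\<rfloor>)"
  have "0 \<le> \<lfloor>real q * s\<rfloor>" using assms by simp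
  then have p: "real p \<le> real q * s + 1" "real q * s < real p"
    unfolding p_def by linarith+
  have *: "real p / real q < a" "s \<le> real p / real q"
    using q q1 p \<open>s < a\<close> by (auto simp: field_simps)
  show "\<forall>\<^sub>F x in at_top. incr s (cdf M) x / g x < a"
    using order_tendstoD(2)[OF incr_ratio_rational[OF q1] *(1)] g_eventually_pos
  proof eventually_elim
    case (elim x)
    have "incr s (cdf M) x / g x \<le> incr (real p / real q) (cdf M) x / g x"
      using elim * by (intro divide_right_mono incr_mono) auto
    with elim show ?case by linarith
  qed
qed

text \<open>\<open>g (x + t)\<close> is the difference of the increments of lengths
  \<open>t + 1\<close> and \<open>t\<close> at \<open>x\<close>; negative \<open>t\<close> follows
  by moving the base point and inverting the ratio.\<close>

lemma g_shift: "((\<lambda>x. g (x + t) / g x) \<longlongrightarrow> 1) at_top"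
proof -
  have pos: "((\<lambda>x. g (x + t) / g x) \<longlongrightarrow> 1) at_top" if "t \<ge> 0" for t
  proof -
    have "((\<lambda>x. incr (t + 1) (cdf M) x / g x - incr t (cdf M) x / g x) \<longlongrightarrow> t + 1 - t) at_top"
      using that by (intro tendsto_diff incr_ratio) auto
    then show ?thesis
      by (simp add: incr_def diff_divide_distrib[symmetric] algebra_simps)
  qed
  show ?thesis
  proof (cases "t \<ge> 0")
    case False
    then have "((\<lambda>x. g (x + t + - t) / g (x + t)) \<longlongrightarrow> 1) at_top"
      by (intro filterlim_compose[OF pos filterlim_add_const_at_top]) auto
    then have "((\<lambda>x. inverse (g (x + t + - t) / g (x + t))) \<longlongrightarrow> inverse 1) at_top"
      by (rule tendsto_inverse) simp
    then show ?thesis by simp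
  qed (rule pos)
qed

text \<open>At most \<open>s + 1\<close> unit intervals cover the interval, each of mass at most
  \<open>K * g x\<close>. Growth only linear in \<open>s\<close> keeps exponential averages
  finite.\<close>

lemma incr_le:
  assumes "x \<ge> x0" "s \<ge> 0"
  shows "incr s (cdf M) x \<le> K * (s + 1) * g x"
proof -
  define n where "n = nat \<lceil>s\<rceil>"
  have n: "s \<le> real n" "real n \<le> s + 1" using assms by (auto simp: n_def)
  have "incr s (cdf M) x \<le> incr (real n * 1) (cdf M) x" using n by (intro incr_mono) simp
  also have "\<dots> = (\<Sum>j<n. g (x + real j * 1))" by (rule incr_of_nat_mult)
  also have "\<dots> \<le> (\<Sum>j<n. K * g x)" using assms by (intro sum_mono local_dom) auto
  also have "\<dots> = K * real n * g x" by simp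
  also have "\<dots> \<le> K * (s + 1) * g x"
    using n K_ge_1 local_pos[OF assms(1)] by (intro mult_right_mono mult_left_mono) auto
  finally show ?thesis .
qed

text \<open>For the tilted law this is \<open>exp (\<kappa> * u) * P (log A > u) / \<theta>\<close>,
  the rescaled tail of a single step.\<close>

definition exp_tail :: "real \<Rightarrow> real \<Rightarrow> real" where
  "exp_tail \<kappa> u = (\<integral>y. indicator {u<..} y * exp (\<kappa> * (u - y)) \<partial>M)"

text \<open>The integral of an exponential against the tail beyond \<open>u\<close> is an average of the increments
  \<open>incr s (cdf M) u\<close> over an exponentially distributed length \<open>s\<close>.\<close>

lemma exp_tail_eq:
  assumes \<kappa>: "\<kappa> > 0"
  shows "exp_tail \<kappa> u = (\<integral>s. exponential_density \<kappa> s * incr s (cdf M) u \<partial>lborel)"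
proof -
  define E where "E = density lborel (exponential_density \<kappa>)"
  interpret E: prob_space E unfolding E_def by (rule prob_space_exponential_density[OF \<kappa>])
  have [measurable_cong, simp]: "sets E = sets borel" by (simp add: E_def)
  have [simp]: "space E = UNIV" by (simp add: E_def)
  have D: "distributed E lborel (\<lambda>s. s) (exponential_density \<kappa>)"
    unfolding distributed_def using distr_id[of lborel]
    by (auto simp: E_def distr_id2)
  have atLeast: "measure E {a..} = exp (- \<kappa> * a)" if "a \<ge> 0" for a
  proof -
    have "AE s in E. s \<noteq> a"
      unfolding E_def using AE_lborel_singleton[of a]
      by (subst AE_density) (auto elim!: eventually_mono)
    then have "measure E {a..} = measure E {a<..}"
      by (intro E.finite_measure_eq_AE) (auto elim!: eventually_mono)
    also have "\<dots> = exp (- \<kappa> * a)"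
      using E.exponential_distributedD_gt[OF D that \<kappa>] by (simp add: greaterThan_def mult.commute)
    finally show ?thesis .
  qed
  \<comment> \<open>The weight \<open>exp (\<kappa> * (u - y))\<close> is the probability that an
    exponential variable is at least \<open>y - u\<close>. Integrating \<open>f\<close> over
    \<open>s\<close> first gives \<open>exp_tail\<close>, over \<open>y\<close> first the mass of
    \<open>{u<..u + s}\<close>.\<close>
  define f where "f y s = (indicator {u<..} y * indicator {y - u..} s :: real)" for y s
  have "exp_tail \<kappa> u = (\<integral>y. (\<integral>s. f y s \<partial>E) \<partial>M)"
    unfolding exp_tail_def
    by (intro Bochner_Integration.integral_cong refl)
       (auto simp: f_def atLeast algebra_simps split: split_indicator)
  also have "\<dots> = (\<integral>s. (\<integral>y. f y s \<partial>M) \<partial>E)"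
  proof (rule Fubini_bounded[where B=1])
    show "case_prod f \<in> borel_measurable (M \<Otimes>\<^sub>M E)"
      unfolding f_def indicator_def by (measurable, auto)
  qed (auto simp: f_def prob_space_axioms E.prob_space_axioms split: split_indicator)
  also have "\<dots> = (\<integral>s. (if s \<ge> 0 then incr s (cdf M) u else 0) \<partial>E)"
  proof (intro Bochner_Integration.integral_cong refl)
    fix s
    have "(\<integral>y. f y s \<partial>M) = (\<integral>y. indicator {u<..u + s} y \<partial>M)"
      by (intro Bochner_Integration.integral_cong refl) (auto simp: f_def split: split_indicator)
    then show "(\<integral>y. f y s \<partial>M) = (if s \<ge> 0 then incr s (cdf M) u else 0)"
      by (simp add: incr_eq_measure)
  qed
  also have "\<dots> = (\<integral>s. exponential_density \<kappa> s * (if s \<ge> 0 then incr s (cdf M) u else 0) \<partial>lborel)"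
    unfolding E_def incr_def using \<kappa>
    by (subst integral_density) (auto simp: exponential_density_nonneg)
  also have "\<dots> = (\<integral>s. exponential_density \<kappa> s * incr s (cdf M) u \<partial>lborel)"
    by (intro Bochner_Integration.integral_cong refl) (auto simp: exponential_density_def)
  finally show ?thesis .
qed

lemma exp_tail_le:
  assumes \<kappa>: "\<kappa> > 0" and u: "u \<ge> x0"
  shows "exp_tail \<kappa> u \<le> K * (1 / \<kappa> + 1) * g u"
proof -
  note [simp] = exponential_mean[OF \<kappa>]
  have "exp_tail \<kappa> u \<le> (\<integral>s. K * g u * (exponential_density \<kappa> s * s) + K * g u * exponential_density \<kappa> s \<partial>lborel)"
    unfolding exp_tail_eq[OF \<kappa>]
  proof (rule integral_mono')
    fix s
    show "exponential_density \<kappa> s * incr s (cdf M) u \<le> K * g u * (exponential_density \<kappa> s * s) + K * g u * exponential_density \<kappa> s"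
    proof (cases "s \<ge> 0")
      case True
      have "exponential_density \<kappa> s * incr s (cdf M) u \<le> exponential_density \<kappa> s * (K * (s + 1) * g u)"
        by (intro mult_left_mono incr_le u True exponential_density_nonneg \<kappa>)
      then show ?thesis by (simp add: algebra_simps)
    qed (simp add: exponential_density_def)
    show "0 \<le> K * g u * (exponential_density \<kappa> s * s) + K * g u * exponential_density \<kappa> s"
      using K_ge_1 local_pos[OF u] \<kappa> by (auto simp: exponential_density_def)
  qed auto
  also have "\<dots> = K * g u * (1 / \<kappa>) + K * g u * 1"
    using prob_space.prob_space[OF prob_space_exponential_density[OF \<kappa>]] \<kappa>
    by (simp add: measure_def emeasure_density nn_integral_eq_integral exponential_density_nonneg integral_nonneg_AE)
  finally show ?thesis by (simp add: algebra_simps)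
qed

text \<open>In the average of \<open>exp_tail_eq\<close> the ratios tend to \<open>s\<close>, whose
  mean is \<open>1 / \<kappa>\<close>; \<open>incr_le\<close> supplies the integrable dominating
  function.\<close>

lemma exp_tail_limit:
  assumes \<kappa>: "\<kappa> > 0"
  shows "((\<lambda>u. exp_tail \<kappa> u / g u) \<longlongrightarrow> 1 / \<kappa>) at_top"
proof -
  have "((\<lambda>u. \<integral>s. exponential_density \<kappa> s * (incr s (cdf M) u / g u) \<partial>lborel)
      \<longlongrightarrow> (\<integral>s. exponential_density \<kappa> s * s \<partial>lborel)) at_top"
  proof (rule integral_dominated_convergence_at_top)
    show "AE s in lborel. ((\<lambda>u. exponential_density \<kappa> s * (incr s (cdf M) u / g u)) \<longlongrightarrow> exponential_density \<kappa> s * s) at_top"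
    proof (rule AE_I2)
      fix s :: real
      show "((\<lambda>u. exponential_density \<kappa> s * (incr s (cdf M) u / g u)) \<longlongrightarrow> exponential_density \<kappa> s * s) at_top"
        by (cases "s \<ge> 0", intro tendsto_mult tendsto_const incr_ratio)
           (simp_all add: exponential_density_def)
    qed
    show "integrable lborel (\<lambda>s. K * (exponential_density \<kappa> s * s) + K * exponential_density \<kappa> s)"
      using exponential_mean[OF \<kappa>] by simp
    show "\<forall>\<^sub>F u in at_top. AE s in lborel. norm (exponential_density \<kappa> s * (incr s (cdf M) u / g u))
        \<le> K * (exponential_density \<kappa> s * s) + K * exponential_density \<kappa> s"
      using eventually_ge_at_top[of x0]
    proof eventually_elim
      case (elim u)
      show ?case
      proof (rule AE_I2)
        fix s :: real
        show "norm (exponential_density \<kappa> s * (incr s (cdf M) u / g u))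
          \<le> K * (exponential_density \<kappa> s * s) + K * exponential_density \<kappa> s"
        proof (cases "s \<ge> 0")
          case True
          have "exponential_density \<kappa> s * (incr s (cdf M) u / g u) \<le> exponential_density \<kappa> s * (K * (s + 1))"
            using incr_le[OF elim True] local_pos[OF elim] \<kappa>
            by (intro mult_left_mono exponential_density_nonneg) (auto simp: field_simps)
          then show ?thesis
            using incr_nonneg[OF True, of u] local_pos[OF elim] \<kappa>
            by (simp add: algebra_simps abs_mult exponential_density_nonneg)
        qed (simp add: exponential_density_def)
      qed
    qed
  qed (auto simp: incr_def)
  moreover have "exp_tail \<kappa> u / g u = (\<integral>s. exponential_density \<kappa> s * (incr s (cdf M) u / g u) \<partial>lborel)" for u
    unfolding exp_tail_eq[OF \<kappa>] by (simp add: times_divide_eq_right flip: integral_divide_zero)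
  ultimately show ?thesis by (simp only: exponential_mean(3)[OF \<kappa>])
qed

subsection \<open>Renewal asymptotics\<close>

text \<open>Convolving \<open>\<phi>\<close> with the law, the first jump \<open>y\<close> is either moderate (\<open>low\<close>), or
  carries almost the whole distance \<open>x\<close> (\<open>high\<close>), or lies in between (\<open>mid\<close>).\<close>

definition low :: "(real \<Rightarrow> real) \<Rightarrow> real \<Rightarrow> real \<Rightarrow> real" where
  "low \<phi> h x = (\<integral>y. indicator {..h} y * \<phi> (x - y) \<partial>M)"

definition mid :: "(real \<Rightarrow> real) \<Rightarrow> real \<Rightarrow> real \<Rightarrow> real" where
  "mid \<phi> h x = (\<integral>y. indicator {h<..x - h} y * \<phi> (x - y) \<partial>M)"

definition high :: "(real \<Rightarrow> real) \<Rightarrow> real \<Rightarrow> real \<Rightarrow> real" where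
  "high \<phi> h x = (\<integral>y. indicator {x - h<..} y * \<phi> (x - y) \<partial>M)"

lemma integral_split:
  assumes int: "integrable M (\<lambda>y. \<phi> (x - y))" and "2 * h \<le> x"
  shows "(\<integral>y. \<phi> (x - y) \<partial>M) = low \<phi> h x + mid \<phi> h x + high \<phi> h x"
proof -
  note i = integrable_indicator_mult[OF int]
  have "low \<phi> h x + mid \<phi> h x + high \<phi> h x =
    (\<integral>y. indicator {..h} y * \<phi> (x - y) + indicator {h<..x - h} y * \<phi> (x - y)
       + indicator {x - h<..} y * \<phi> (x - y) \<partial>M)"
    unfolding low_def mid_def high_def
    by (simp add: i)
  also have "\<dots> = (\<integral>y. \<phi> (x - y) \<partial>M)"
    using \<open>2 * h \<le> x\<close> by (intro Bochner_Integration.integral_cong refl) (auto split: split_indicator)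
  finally show ?thesis by simp
qed

lemma integrable_g [simp]: "integrable M (\<lambda>y. g (x - y))"
  by (intro integrable_const_bound[where B=1]) (simp_all add: incr_nonneg incr_le_1)

text \<open>Dominated convergence over all \<open>y \<le> h\<close>: each ratio tends to 1, and
  however negative \<open>y\<close> is, \<open>g (x - y)\<close> is at most
  \<open>K * g (x - h)\<close>, eventually below \<open>2 * K * g x\<close>.\<close>

lemma low_g_limit: "((\<lambda>x. low g h x / g x) \<longlongrightarrow> cdf M h) at_top"
proof -
  have "((\<lambda>x. \<integral>y. indicator {..h} y * (g (x - y) / g x) \<partial>M) \<longlongrightarrow> (\<integral>y. indicator {..h} y \<partial>M)) at_top"
  proof (rule integral_dominated_convergence_at_top)
    show "integrable M (\<lambda>_. 2 * K)" by simp
    have "((\<lambda>x. indicator {..h} y * (g (x - y) / g x)) \<longlongrightarrow> indicator {..h} y) at_top" for y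
      using tendsto_mult_left[OF g_shift[of "- y"], of "indicator {..h} y"] by simp
    then show "AE y in M. ((\<lambda>x. indicator {..h} y * (g (x - y) / g x)) \<longlongrightarrow> indicator {..h} y) at_top"
      by simp
    have "\<forall>\<^sub>F x in at_top. g (x + - h) / g x < 2"
      by (rule order_tendstoD(2)[OF g_shift]) simp
    then show "\<forall>\<^sub>F x in at_top. AE y in M. norm (indicator {..h} y * (g (x - y) / g x)) \<le> 2 * K"
      using eventually_ge_at_top[of "x0 + h"] g_eventually_pos
    proof eventually_elim
      case (elim x)
      have "norm (indicator {..h} y * (g (x - y) / g x)) \<le> 2 * K" for y
      proof (cases "y \<le> h")
        case True
        have "g (x - y) \<le> K * g (x - h)"
          using elim True by (intro local_dom) auto
        also have "\<dots> \<le> K * (2 * g x)"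
          using elim K_ge_1 by (intro mult_left_mono) (auto simp: field_simps)
        finally show ?thesis
          using True elim incr_nonneg[of 1 "x - y"] by (simp add: abs_mult field_simps)
      qed (use K_ge_1 in auto)
      then show ?case by simp
    qed
  qed (auto simp: incr_def)
  then show ?thesis
    by (simp add: low_def cdf_def)
qed

text \<open>If \<open>Y + Z\<close> lands in \<open>(x, x + 1]\<close> and \<open>Z \<le> h\<close>, then \<open>Y > x - h\<close>.\<close>

lemma low_g_le_high_g: "low g h x \<le> high g h x"
proof -
  define f where "f z y = (indicator {..h} z * indicator {x - z<..x - z + 1} y :: real)" for z y
  have meas [measurable]: "case_prod f \<in> borel_measurable (M \<Otimes>\<^sub>M M)"
    unfolding f_def indicator_def by (measurable, auto)
  have [measurable]: "(\<lambda>z. f z y) \<in> borel_measurable M" for y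
    unfolding f_def indicator_def by (measurable, auto)
  have f01: "0 \<le> f z y" "f z y \<le> 1" for z y by (auto simp: f_def split: split_indicator)
  have "low g h x = (\<integral>z. (\<integral>y. f z y \<partial>M) \<partial>M)"
    unfolding low_def by (simp add: f_def incr_eq_measure)
  also have "\<dots> = (\<integral>y. (\<integral>z. f z y \<partial>M) \<partial>M)"
    by (intro Fubini_bounded[where B=1] meas)
       (auto simp: f_def prob_space_axioms split: split_indicator)
  also have "\<dots> \<le> (\<integral>y. indicator {x - h<..} y * g (x - y) \<partial>M)"
  proof (rule integral_mono')
    show "integrable M (\<lambda>y. indicator {x - h<..} y * g (x - y))"
      by (rule integrable_indicator_mult) auto
    fix y
    have "(\<integral>z. f z y \<partial>M) \<le> (\<integral>z. indicator {x - h<..} y * indicator {x - y<..x - y + 1} z \<partial>M)"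
    proof (rule integral_mono)
      show "integrable M (\<lambda>z. f z y)"
        using f01 by (intro integrable_const_bound[where B=1]) auto
      show "integrable M (\<lambda>z. indicator {x - h<..} y * indicator {x - y<..x - y + 1} z :: real)"
        by (intro integrable_const_bound[where B=1]) (auto split: split_indicator)
    qed (auto simp: f_def split: split_indicator)
    then show "(\<integral>z. f z y \<partial>M) \<le> indicator {x - h<..} y * g (x - y)"
      by (simp add: incr_eq_measure)
    show "0 \<le> indicator {x - h<..} y * g (x - y)"
      by (simp add: incr_nonneg)
  qed
  also have "\<dots> = high g h x" by (simp add: high_def)
  finally show ?thesis .
qed

text \<open>The single-big-jump estimate: the total is asymptotic to \<open>2 * g x\<close>, and
  \<open>low\<close> and \<open>high\<close> each account for at least about
  \<open>cdf M h * g x\<close>, so for large \<open>h\<close> little is left for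
  \<open>mid\<close>.\<close>

lemma mid_g_le:
  "2 * h \<le> x \<Longrightarrow> mid g h x \<le> (\<integral>y. g (x - y) \<partial>M) - 2 * low g h x"
  using integral_split[of g x h] low_g_le_high_g[of h x] by simp

lemma exp_tail_shift_limit:
  assumes "\<kappa> > 0"
  shows "((\<lambda>x. exp_tail \<kappa> (x - t) / g x) \<longlongrightarrow> 1 / \<kappa>) at_top"
proof -
  have "((\<lambda>x. exp_tail \<kappa> (x + - t) / g (x + - t) * (g (x + - t) / g x)) \<longlongrightarrow> 1 / \<kappa> * 1) at_top"
    by (intro tendsto_mult g_shift filterlim_compose[OF exp_tail_limit filterlim_add_const_at_top] assms)
  then show ?thesis
    unfolding mult_1_right
  proof (rule Lim_transform_eventually)
    show "\<forall>\<^sub>F x in at_top. exp_tail \<kappa> (x + - t) / g (x + - t) * (g (x + - t) / g x) = exp_tail \<kappa> (x - t) / g x"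
      using eventually_ge_at_top[of "x0 + t"]
    proof eventually_elim
      case (elim x)
      then show ?case using local_pos[of "x - t"] by simp
    qed
  qed
qed

lemma exp_tail_nonneg: "0 \<le> exp_tail \<kappa> u"
  unfolding exp_tail_def by (intro integral_nonneg_AE) auto

lemma integrable_exp_tail: "\<kappa> > 0 \<Longrightarrow> integrable M (\<lambda>y. indicator {u<..} y * exp (\<kappa> * (u - y)))"
  by (intro integrable_const_bound[where B=1] AE_I2)
     (auto intro!: mult_nonneg_nonpos split: split_indicator)

lemma exp_tail_le_1: "\<kappa> > 0 \<Longrightarrow> exp_tail \<kappa> u \<le> 1"
  unfolding exp_tail_def
  by (intro integral_le_const integrable_exp_tail AE_I2)
     (auto intro!: mult_nonneg_nonpos split: split_indicator)

lemma borel_measurable_exp_tail [measurable]: "exp_tail \<kappa> \<in> borel_measurable borel"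
proof -
  have "exp_tail \<kappa> = (\<lambda>u. \<integral>y. (if u < y then exp (\<kappa> * (u - y)) else 0) \<partial>M)"
    by (intro ext) (auto simp: exp_tail_def indicator_def intro!: Bochner_Integration.integral_cong)
  then show ?thesis by simp
qed

text \<open>Writing the tail probability in \<open>\<phi>\<close> as an integral over
  \<open>w\<close> and exchanging integrals gives the average of
  \<open>exp (\<kappa> * Z w) * exp_tail \<kappa> (x - Z w)\<close>, where the second factor is
  asymptotic to \<open>g x / \<kappa>\<close>. Only \<open>z < h\<close> enters, so \<open>Z\<close>
  may be a truncated variable.\<close>

lemma high_limit:
  fixes Z :: "'b \<Rightarrow> real"
  assumes N: "prob_space N" and Z [measurable]: "Z \<in> borel_measurable N"
    and Zh: "\<And>w. 0 \<le> Z w \<and> Z w \<le> h" and \<kappa>: "\<kappa> > 0"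
    and \<phi>: "\<And>z. z < h \<Longrightarrow> \<phi> z = exp (\<kappa> * z) * measure N {w \<in> space N. Z w > z}"
  shows "((\<lambda>x. high \<phi> h x / g x) \<longlongrightarrow> (\<integral>w. exp (\<kappa> * Z w) \<partial>N) / \<kappa>) at_top"
proof -
  interpret N: prob_space N by fact
  have int: "integrable N (\<lambda>w. exp (\<kappa> * Z w))"
    using Zh \<kappa> by (intro N.integrable_const_bound[where B="exp (\<kappa> * h)"]) auto
  have high: "high \<phi> h x = (\<integral>w. exp (\<kappa> * Z w) * exp_tail \<kappa> (x - Z w) \<partial>N)" for x
  proof -
    define f where "f y w = indicator {x - h<..} y * (exp (\<kappa> * (x - y)) * indicator {x - y<..} (Z w))" for y w
    have meas [measurable]: "case_prod f \<in> borel_measurable (M \<Otimes>\<^sub>M N)"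
      unfolding f_def indicator_def by (measurable, auto)
    have "high \<phi> h x = (\<integral>y. (\<integral>w. f y w \<partial>N) \<partial>M)"
      unfolding high_def
    proof (intro Bochner_Integration.integral_cong refl)
      fix y
      have "(\<integral>w. indicator {x - y<..} (Z w) \<partial>N) = measure N {w \<in> space N. Z w > x - y}"
        by (subst Bochner_Integration.integral_cong[OF refl, where g="indicator {w \<in> space N. Z w > x - y}"])
           (auto split: split_indicator intro!: arg_cong[where f="measure N"])
      then show "indicator {x - h<..} y * \<phi> (x - y) = (\<integral>w. f y w \<partial>N)"
        by (auto simp: f_def \<phi> split: split_indicator)
    qed
    also have "\<dots> = (\<integral>w. (\<integral>y. f y w \<partial>M) \<partial>N)"
    proof (rule Fubini_bounded[where B="exp (\<kappa> * h)"])
      show "\<bar>f y w\<bar> \<le> exp (\<kappa> * h)" for y w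
        using \<kappa> by (auto simp: f_def split: split_indicator)
    qed (auto simp: prob_space_axioms N.prob_space_axioms)
    also have "\<dots> = (\<integral>w. exp (\<kappa> * Z w) * exp_tail \<kappa> (x - Z w) \<partial>N)"
    proof (intro Bochner_Integration.integral_cong refl)
      fix w
      \<comment> \<open>As \<open>Z w \<le> h\<close>, the condition \<open>y > x - Z w\<close>
        implies \<open>y > x - h\<close>, which removes the outer indicator.\<close>
      have "(\<integral>y. f y w \<partial>M) = (\<integral>y. exp (\<kappa> * Z w) * (indicator {x - Z w<..} y * exp (\<kappa> * (x - Z w - y))) \<partial>M)"
        using Zh[of w] by (intro Bochner_Integration.integral_cong refl)
          (auto simp: f_def algebra_simps simp flip: exp_add split: split_indicator)
      then show "(\<integral>y. f y w \<partial>M) = exp (\<kappa> * Z w) * exp_tail \<kappa> (x - Z w)"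
        by (simp add: exp_tail_def)
    qed
    finally show ?thesis .
  qed
  have "((\<lambda>x. \<integral>w. exp (\<kappa> * Z w) * (exp_tail \<kappa> (x - Z w) / g x) \<partial>N) \<longlongrightarrow> (\<integral>w. exp (\<kappa> * Z w) * (1 / \<kappa>) \<partial>N)) at_top"
  proof (rule integral_dominated_convergence_at_top)
    show "AE w in N. ((\<lambda>x. exp (\<kappa> * Z w) * (exp_tail \<kappa> (x - Z w) / g x)) \<longlongrightarrow> exp (\<kappa> * Z w) * (1 / \<kappa>)) at_top"
      by (intro AE_I2 tendsto_mult_left exp_tail_shift_limit \<kappa>)
    \<comment> \<open>In the dominating function, \<open>C\<close> comes from
      \<open>exp_tail_le\<close>, \<open>K\<close> from replacing \<open>x - Z w\<close> by
      \<open>x - h\<close>, and 2 from undoing that shift.\<close>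
    define C where "C = K * (1 / \<kappa> + 1)"
    have C: "C > 0" using K_ge_1 \<kappa> by (auto simp: C_def intro!: mult_pos_pos add_pos_pos)
    show "integrable N (\<lambda>w. exp (\<kappa> * Z w) * (C * K * 2))"
      using int by simp
    have "\<forall>\<^sub>F x in at_top. g (x + - h) / g x < 2"
      by (rule order_tendstoD(2)[OF g_shift]) simp
    then show "\<forall>\<^sub>F x in at_top. AE w in N. norm (exp (\<kappa> * Z w) * (exp_tail \<kappa> (x - Z w) / g x)) \<le> exp (\<kappa> * Z w) * (C * K * 2)"
      using eventually_ge_at_top[of "x0 + h"] g_eventually_pos
    proof eventually_elim
      case (elim x)
      have "norm (exp (\<kappa> * Z w) * (exp_tail \<kappa> (x - Z w) / g x)) \<le> exp (\<kappa> * Z w) * (C * K * 2)" for w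
      proof -
        have "exp_tail \<kappa> (x - Z w) \<le> C * g (x - Z w)"
          using exp_tail_le[OF \<kappa>, of "x - Z w"] Zh[of w] elim by (simp add: C_def)
        also have "\<dots> \<le> C * (K * g (x - h))"
          using Zh[of w] elim C by (intro mult_left_mono local_dom) auto
        also have "\<dots> \<le> C * (K * (2 * g x))"
          using elim C K_ge_1 by (intro mult_left_mono) (auto simp: field_simps)
        finally have "exp_tail \<kappa> (x - Z w) / g x \<le> C * K * 2"
          using elim by (simp add: field_simps)
        then have "exp (\<kappa> * Z w) * (exp_tail \<kappa> (x - Z w) / g x) \<le> exp (\<kappa> * Z w) * (C * K * 2)"
          by (intro mult_left_mono) auto
        then show ?thesis
          using exp_tail_nonneg[of \<kappa> "x - Z w"] elim by (simp add: abs_mult)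
      qed
      then show ?case by simp
    qed
  qed auto
  then show ?thesis by (simp add: high)
qed

text \<open>A Kesten-type bound. The contraction \<open>\<theta> < 1\<close> absorbs the factor \<open>2 - \<theta>\<close> by which convolution with
  \<open>g\<close> far to the right can exceed \<open>g\<close>.\<close>

lemma kesten_bound:
  fixes p :: "nat \<Rightarrow> real \<Rightarrow> real"
  assumes \<kappa>: "\<kappa> > 0" and \<theta>: "0 < \<theta>" "\<theta> < 1"
    and exp_int: "integrable M (\<lambda>y. exp (- \<kappa> * y))"
    and p: "\<And>n z. 0 \<le> p n z" "\<And>n z. p n z \<le> 1" and p_meas [measurable]: "\<And>n. p n \<in> borel_measurable borel"
    and p0: "\<And>z. 0 \<le> z \<Longrightarrow> p 0 z = 0"
    and rec: "\<And>n x. 0 \<le> x \<Longrightarrow>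
      exp (\<kappa> * x) * p (Suc n) x = \<theta> * (\<integral>y. exp (\<kappa> * (x - y)) * p n (x - y) \<partial>M)"
  obtains B x1 where "B \<ge> 0" "x1 \<ge> x0" "\<And>n x. x \<ge> x1 \<Longrightarrow> exp (\<kappa> * x) * p n x \<le> B * g x"
proof -
  \<comment> \<open>With \<open>cdf M h > \<theta>\<close>, subtracting \<open>low\<close> once from
    the total, which is about \<open>2 * g x\<close>, leaves less than
    \<open>(2 - \<theta>) * g x\<close>.\<close>
  have "\<forall>\<^sub>F h in at_top. cdf M h > \<theta>"
    by (rule order_tendstoD(1)[OF cdf_lim_at_top_prob \<theta>(2)])
  then obtain h where h: "cdf M h > \<theta>" by (auto simp: eventually_at_top_linorder)
  have "((\<lambda>x. (\<integral>y. g (x - y) \<partial>M) / g x - low g h x / g x) \<longlongrightarrow> 2 - cdf M h) at_top"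
    by (intro tendsto_diff convolution_limit low_g_limit)
  then have "\<forall>\<^sub>F x in at_top. (\<integral>y. g (x - y) \<partial>M) / g x - low g h x / g x < 2 - \<theta>"
    using h by (intro order_tendstoD) auto
  then obtain X where X: "\<And>x. x \<ge> X \<Longrightarrow> (\<integral>y. g (x - y) \<partial>M) / g x - low g h x / g x < 2 - \<theta>"
    by (auto simp: eventually_at_top_linorder)
  \<comment> \<open>\<open>x1 \<ge> h\<close> puts every jump \<open>y \<le> x - x1\<close> among
    the low and middle ones; \<open>x1 \<ge> 2 * h\<close> makes the splitting applicable.\<close>
  define x1 where "x1 = Max {X, 2 * h, h, x0, 0}"
  have x1: "x1 \<ge> X" "x1 \<ge> 2 * h" "x1 \<ge> h" "x1 \<ge> x0" "x1 \<ge> 0" by (auto simp: x1_def)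
  have near: "(\<integral>y. indicator {..x - x1} y * g (x - y) \<partial>M) \<le> (2 - \<theta>) * g x" if "x \<ge> x1" for x
  proof -
    have "(\<integral>y. indicator {..x - x1} y * g (x - y) \<partial>M)
        \<le> (\<integral>y. indicator {..h} y * g (x - y) + indicator {h<..x - h} y * g (x - y) \<partial>M)"
      using x1 that
      by (intro integral_mono Bochner_Integration.integrable_add integrable_indicator_mult integrable_g)
         (auto simp: incr_nonneg split: split_indicator)
    also have "\<dots> = low g h x + mid g h x"
      unfolding low_def mid_def
      by (intro Bochner_Integration.integral_add integrable_indicator_mult integrable_g) auto
    also have "\<dots> \<le> (\<integral>y. g (x - y) \<partial>M) - low g h x"
      using mid_g_le[of h x] x1 that by simp
    also have "\<dots> \<le> (2 - \<theta>) * g x"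
      using X[of x] x1 that local_pos[of x] by (simp add: pos_divide_less_eq flip: diff_divide_distrib)
    finally show ?thesis .
  qed
  have "\<forall>\<^sub>F x in at_top. exp_tail \<kappa> (x - x1) / g x < 1 / \<kappa> + 1"
    by (rule order_tendstoD(2)[OF exp_tail_shift_limit[OF \<kappa>]]) simp
  then obtain X2 where X2: "\<And>x. x \<ge> X2 \<Longrightarrow> exp_tail \<kappa> (x - x1) / g x < 1 / \<kappa> + 1"
    by (auto simp: eventually_at_top_linorder)
  define X3 where "X3 = max X2 x1"
  have X3: "X3 \<ge> x1" "X3 \<ge> X2" "g X3 > 0" using x1 by (auto simp: X3_def intro!: local_pos)
  \<comment> \<open>Beyond \<open>X3\<close> the limit bounds the ratio by
    \<open>1 / \<kappa> + 1\<close>. Between \<open>x1\<close> and \<open>X3\<close> the trivial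
    bound \<open>exp_tail \<le> 1\<close> suffices, since there \<open>g x\<close> is at least
    \<open>g X3 / K\<close>.\<close>
  define D where "D = 1 / \<kappa> + 1 + K / g X3"
  have D: "D \<ge> 0" using \<kappa> K_ge_1 X3 by (auto simp: D_def)
  have far: "exp_tail \<kappa> (x - x1) \<le> D * g x" if "x \<ge> x1" for x
  proof (cases "x \<ge> X3")
    case True
    then have "exp_tail \<kappa> (x - x1) \<le> (1 / \<kappa> + 1) * g x"
      using X2[of x] X3 local_pos[of x] x1 that by (simp add: field_simps)
    also have "\<dots> \<le> D * g x"
      using K_ge_1 X3 local_pos[of x] x1 that by (intro mult_right_mono) (auto simp: D_def)
    finally show ?thesis .
  next
    case False
    then have "g X3 \<le> K * g x" using x1 that by (intro local_dom) auto
    then have "1 \<le> K / g X3 * g x" using X3 by (simp add: field_simps)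
    also have "\<dots> \<le> D * g x"
      using \<kappa> local_pos[of x] x1 that by (intro mult_right_mono) (auto simp: D_def)
    finally show ?thesis using exp_tail_le_1[OF \<kappa>, of "x - x1"] by simp
  qed
  \<comment> \<open>\<open>B\<close> is the fixed point of \<open>B = \<theta> * (B * (2 - \<theta>)
    + exp (\<kappa> * x1) * D)\<close>; the denominator arises as
    \<open>1 - \<theta> * (2 - \<theta>) = (1 - \<theta>)\<^sup>2\<close>.\<close>
  define B where "B = \<theta> * exp (\<kappa> * x1) * D / (1 - \<theta>)\<^sup>2"
  have B: "B \<ge> 0" using D \<theta> by (auto simp: B_def)
  have B_eq: "\<theta> * (B * (2 - \<theta>) + exp (\<kappa> * x1) * D) = B"
  proof -
    have "B * (1 - \<theta>)\<^sup>2 = \<theta> * exp (\<kappa> * x1) * D" using \<theta> by (simp add: B_def)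
    then show ?thesis by (simp add: power2_eq_square algebra_simps)
  qed
  have "exp (\<kappa> * x) * p n x \<le> B * g x" if "x \<ge> x1" for n x
    using that
  proof (induction n arbitrary: x)
    case 0
    then show ?case using p0[of x] B x1 local_pos[of x] by simp
  next
    case (Suc n)
    let ?f = "\<lambda>z. exp (\<kappa> * z) * p n z"
    have int: "integrable M (\<lambda>y. ?f (x - y))"
    proof (rule Bochner_Integration.integrable_bound)
      show "integrable M (\<lambda>y. exp (\<kappa> * x) * exp (- \<kappa> * y))"
        using exp_int by simp
      show "AE y in M. norm (?f (x - y)) \<le> norm (exp (\<kappa> * x) * exp (- \<kappa> * y))"
        using p mult_left_mono[OF p(2), of "exp (\<kappa> * (x - y))" for y]
        by (intro AE_I2) (auto simp: abs_mult algebra_simps simp flip: exp_add)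
    qed measurable
    \<comment> \<open>Jumps with \<open>x - y \<ge> x1\<close> fall under the induction hypothesis;
      for larger jumps \<open>p n \<le> 1\<close> gives the exponential tail.\<close>
    have "(\<integral>y. ?f (x - y) \<partial>M) \<le> (\<integral>y. B * (indicator {..x - x1} y * g (x - y))
        + exp (\<kappa> * x1) * (indicator {x - x1<..} y * exp (\<kappa> * (x - x1 - y))) \<partial>M)"
    proof (rule integral_mono[OF int])
      show "integrable M (\<lambda>y. B * (indicator {..x - x1} y * g (x - y))
        + exp (\<kappa> * x1) * (indicator {x - x1<..} y * exp (\<kappa> * (x - x1 - y))))"
        by (intro Bochner_Integration.integrable_add integrable_mult_right integrable_exp_tail \<kappa>
            integrable_indicator_mult integrable_g) auto
      fix y
      show "?f (x - y) \<le> B * (indicator {..x - x1} y * g (x - y))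
        + exp (\<kappa> * x1) * (indicator {x - x1<..} y * exp (\<kappa> * (x - x1 - y)))"
      proof (cases "y \<le> x - x1")
        case True
        then show ?thesis using Suc.IH[of "x - y"] by simp
      next
        case False
        have "?f (x - y) \<le> exp (\<kappa> * (x - y))"
          using mult_left_mono[OF p(2), of "exp (\<kappa> * (x - y))" n "x - y"] by simp
        also have "\<dots> = exp (\<kappa> * x1) * exp (\<kappa> * (x - x1 - y))"
          by (simp add: algebra_simps flip: exp_add)
        finally show ?thesis using False by simp
      qed
    qed
    also have "\<dots> = B * (\<integral>y. indicator {..x - x1} y * g (x - y) \<partial>M) + exp (\<kappa> * x1) * exp_tail \<kappa> (x - x1)"
      unfolding exp_tail_def
      by (simp add: integrable_exp_tail \<kappa> integrable_indicator_mult)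
    also have "\<dots> \<le> B * ((2 - \<theta>) * g x) + exp (\<kappa> * x1) * (D * g x)"
      using near[OF Suc.prems] far[OF Suc.prems] B by (intro add_mono mult_left_mono) auto
    finally have "exp (\<kappa> * x) * p (Suc n) x \<le> \<theta> * (B * ((2 - \<theta>) * g x) + exp (\<kappa> * x1) * (D * g x))"
      using rec[of x n] Suc.prems x1 \<theta> by simp
    also have "\<dots> = \<theta> * (B * (2 - \<theta>) + exp (\<kappa> * x1) * D) * g x" by (simp add: algebra_simps)
    finally show ?case by (simp only: B_eq)
  qed
  with B x1 show ?thesis by (intro that) auto
qed

text \<open>\<open>L h\<close> is the limiting weight of the jumps beyond \<open>x - h\<close>. It
  increases to \<open>Ls\<close>, and the limit is the fixed point of the contraction sending
  \<open>r\<close> to \<open>\<theta> * (r + Ls)\<close>, positive because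
  \<open>Ls \<ge> L 0 > 0\<close>.\<close>

lemma renewal_limit:
  assumes \<theta>: "0 < \<theta>" "\<theta> < 1"
    and \<phi>_nonneg: "\<And>x. 0 \<le> \<phi> x" and int: "\<And>x. integrable M (\<lambda>y. \<phi> (x - y))"
    and rec: "\<And>x. 0 \<le> x \<Longrightarrow> \<phi> x = \<theta> * (\<integral>y. \<phi> (x - y) \<partial>M)"
    and B: "B \<ge> 0" and x1: "x1 \<ge> x0" and bound: "\<And>x. x \<ge> x1 \<Longrightarrow> \<phi> x \<le> B * g x"
    and high: "\<And>h. h \<ge> 0 \<Longrightarrow> ((\<lambda>x. high \<phi> h x / g x) \<longlongrightarrow> L h) at_top"
    and L0: "L 0 > 0"
  obtains c where "c > 0" "((\<lambda>x. \<phi> x / g x) \<longlongrightarrow> c) at_top"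
proof -
  note int_ind = integrable_indicator_mult[OF int]
  have L_mono: "L h \<le> L h'" if "0 \<le> h" "h \<le> h'" for h h'
  proof (rule tendsto_le[OF _ high high])
    show "\<forall>\<^sub>F x in at_top. high \<phi> h x / g x \<le> high \<phi> h' x / g x"
      using g_eventually_pos
    proof eventually_elim
      case (elim x)
      have "high \<phi> h x \<le> high \<phi> h' x"
        unfolding high_def using that \<phi>_nonneg
        by (intro integral_mono int_ind) (auto split: split_indicator)
      with elim show ?case by (simp add: divide_right_mono)
    qed
  qed (use that in auto)
  have low_nonneg: "0 \<le> low \<phi> h x" and mid_nonneg: "0 \<le> mid \<phi> h x" for h x
    unfolding low_def mid_def using \<phi>_nonneg by (auto intro!: integral_nonneg_AE)
  \<comment> \<open>\<open>\<theta> * high \<phi> h x\<close> is one of three nonnegative summands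
    of \<open>\<phi> x\<close>, which is at most \<open>B * g x\<close>; hence the supremum of
    \<open>L\<close> is finite.\<close>
  have L_le: "L h \<le> B / \<theta>" if "0 \<le> h" for h
  proof (rule tendsto_upperbound[OF high[OF that]])
    show "\<forall>\<^sub>F x in at_top. high \<phi> h x / g x \<le> B / \<theta>"
      using eventually_ge_at_top[of x1] eventually_ge_at_top[of "2 * h"] eventually_ge_at_top[of 0]
    proof eventually_elim
      case (elim x)
      have "\<theta> * high \<phi> h x \<le> \<theta> * (low \<phi> h x + mid \<phi> h x + high \<phi> h x)"
        using \<theta> low_nonneg mid_nonneg by (intro mult_left_mono) auto
      also have "\<dots> = \<phi> x" using integral_split[OF int elim(2)] rec[OF elim(3)] by simp
      also have "\<dots> \<le> B * g x" using bound elim by simp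
      finally show ?case using \<theta> local_pos[of x] elim x1 by (simp add: field_simps)
    qed
  qed simp
  define Ls where "Ls = (SUP h\<in>{0..}. L h)"
  have bdd: "bdd_above (L ` {0..})" using L_le by (auto intro!: bdd_aboveI2)
  have L_le_Ls: "L h \<le> Ls" if "h \<ge> 0" for h
    unfolding Ls_def using that bdd by (intro cSUP_upper) auto
  have L_lim: "(L \<longlongrightarrow> Ls) at_top"
  proof (rule order_tendstoI)
    fix a assume "a < Ls"
    then obtain h where h: "h \<ge> 0" "a < L h"
      unfolding Ls_def using bdd by (auto simp: less_cSUP_iff)
    show "\<forall>\<^sub>F h in at_top. a < L h"
      using eventually_ge_at_top[of h] by eventually_elim (use L_mono[of h] h in force)
  next
    fix a assume "Ls < a"
    show "\<forall>\<^sub>F h in at_top. L h < a"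
      using eventually_ge_at_top[of 0] by eventually_elim (use L_le_Ls \<open>Ls < a\<close> in force)
  qed

  \<comment> \<open>Constants that eventually bound \<open>\<phi> / g\<close> from above and from
    below; the infimum of \<open>U\<close> and the supremum of \<open>V\<close> stand for the upper
    and lower limits.\<close>
  define U where "U b \<longleftrightarrow> 0 \<le> b \<and> (\<forall>\<^sub>F x in at_top. \<phi> x \<le> b * g x)" for b
  define V where "V a \<longleftrightarrow> 0 \<le> a \<and> (\<forall>\<^sub>F x in at_top. a * g x \<le> \<phi> x)" for a
  have U_step: "U (\<theta> * (b + Ls) + e)" if "U b" "e > 0" for b e
  proof -
    from \<open>U b\<close> obtain X where b: "b \<ge> 0" and X: "\<And>x. x \<ge> X \<Longrightarrow> \<phi> x \<le> b * g x"
      by (auto simp: U_def eventually_at_top_linorder)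
    \<comment> \<open>As \<open>h\<close> grows the middle term vanishes, since
      \<open>2 - 2 * cdf M h\<close> tends to 0. Requiring \<open>h \<ge> x1\<close> below makes
      \<open>bound\<close> applicable on the middle range, where
      \<open>x - y \<ge> h\<close>.\<close>
    have "((\<lambda>h. \<theta> * (b * cdf M h + B * (2 - 2 * cdf M h) + Ls)) \<longlongrightarrow> \<theta> * (b * 1 + B * (2 - 2 * 1) + Ls)) at_top"
      by (intro tendsto_intros cdf_lim_at_top_prob)
    then have "\<forall>\<^sub>F h in at_top. \<theta> * (b * cdf M h + B * (2 - 2 * cdf M h) + Ls) < \<theta> * (b + Ls) + e"
      using \<open>e > 0\<close> by (intro order_tendstoD) auto
    then have "\<forall>\<^sub>F h in at_top. h \<ge> max 0 x1 \<and> \<theta> * (b * cdf M h + B * (2 - 2 * cdf M h) + Ls) < \<theta> * (b + Ls) + e"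
      using eventually_ge_at_top[of "max 0 x1"] by eventually_elim auto
    then obtain h where h: "h \<ge> 0" "h \<ge> x1"
      and e: "\<theta> * (b * cdf M h + B * (2 - 2 * cdf M h) + Ls) < \<theta> * (b + Ls) + e"
      by (auto simp: eventually_at_top_linorder)
    let ?R = "\<lambda>x. \<theta> * (b * (low g h x / g x)
      + B * ((\<integral>y. g (x - y) \<partial>M) / g x - 2 * (low g h x / g x)) + high \<phi> h x / g x)"
    have "(?R \<longlongrightarrow> \<theta> * (b * cdf M h + B * (2 - 2 * cdf M h) + L h)) at_top"
      by (intro tendsto_intros low_g_limit convolution_limit high h)
    moreover have "\<theta> * (b * cdf M h + B * (2 - 2 * cdf M h) + L h) < \<theta> * (b + Ls) + e"
      using e mult_left_mono[OF L_le_Ls[OF h(1)], of \<theta>] \<theta>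
      unfolding distrib_left by linarith
    ultimately have "\<forall>\<^sub>F x in at_top. ?R x < \<theta> * (b + Ls) + e"
      by (rule order_tendstoD)
    then have "\<forall>\<^sub>F x in at_top. \<phi> x \<le> (\<theta> * (b + Ls) + e) * g x"
      using eventually_ge_at_top[of "x1 + h"] eventually_ge_at_top[of "2 * h"]
        eventually_ge_at_top[of "X + h"] g_eventually_pos
    proof eventually_elim
      case (elim x)
      have "low \<phi> h x \<le> (\<integral>y. b * (indicator {..h} y * g (x - y)) \<partial>M)"
        unfolding low_def using X elim
        by (intro integral_mono int_ind integrable_mult_right integrable_indicator_mult integrable_g)
           (auto split: split_indicator)
      then have low: "low \<phi> h x \<le> b * low g h x" by (simp add: low_def)
      have "mid \<phi> h x \<le> (\<integral>y. B * (indicator {h<..x - h} y * g (x - y)) \<partial>M)"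
        unfolding mid_def using bound h elim
        by (intro integral_mono int_ind integrable_mult_right integrable_indicator_mult integrable_g)
           (auto split: split_indicator)
      also have "\<dots> = B * mid g h x" by (simp add: mid_def)
      also have "\<dots> \<le> B * ((\<integral>y. g (x - y) \<partial>M) - 2 * low g h x)"
        by (intro mult_left_mono mid_g_le elim B)
      finally have mid: "mid \<phi> h x \<le> B * ((\<integral>y. g (x - y) \<partial>M) - 2 * low g h x)" .
      have "\<phi> x = \<theta> * (low \<phi> h x + mid \<phi> h x + high \<phi> h x)"
        using integral_split[OF int elim(3)] rec[of x] elim h by simp
      also have "\<dots> \<le> \<theta> * (b * low g h x + B * ((\<integral>y. g (x - y) \<partial>M) - 2 * low g h x) + high \<phi> h x)"
        using low mid \<theta> by (intro mult_left_mono) auto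
      also have "\<dots> = ?R x * g x"
        using elim by (simp add: field_simps)
      also have "\<dots> \<le> (\<theta> * (b + Ls) + e) * g x"
        using elim by (intro mult_right_mono) auto
      finally show ?case .
    qed
    moreover have "0 \<le> \<theta> * (b + Ls) + e"
      using \<theta> b L0 L_le_Ls[of 0] \<open>e > 0\<close> by simp
    ultimately show ?thesis by (simp add: U_def)
  qed
  have V_step: "V (\<theta> * (a + Ls) - e)" if "V a" "e > 0" "0 \<le> \<theta> * (a + Ls) - e" for a e
  proof -
    from \<open>V a\<close> obtain X where a: "a \<ge> 0" and X: "\<And>x. x \<ge> X \<Longrightarrow> a * g x \<le> \<phi> x"
      by (auto simp: V_def eventually_at_top_linorder)
    \<comment> \<open>For the lower bound the middle jumps are dropped, being nonnegative; the
      convergence of \<open>L h\<close> to \<open>Ls\<close> then recovers the full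
      constant.\<close>
    have "((\<lambda>h. \<theta> * (a * cdf M h + L h)) \<longlongrightarrow> \<theta> * (a * 1 + Ls)) at_top"
      by (intro tendsto_intros cdf_lim_at_top_prob L_lim)
    then have "\<forall>\<^sub>F h in at_top. \<theta> * (a + Ls) - e < \<theta> * (a * cdf M h + L h)"
      using \<open>e > 0\<close> by (intro order_tendstoD) auto
    then have "\<forall>\<^sub>F h in at_top. h \<ge> 0 \<and> \<theta> * (a + Ls) - e < \<theta> * (a * cdf M h + L h)"
      using eventually_ge_at_top[of 0] by eventually_elim auto
    then obtain h where h: "h \<ge> 0" and e: "\<theta> * (a + Ls) - e < \<theta> * (a * cdf M h + L h)"
      by (auto simp: eventually_at_top_linorder)
    let ?R = "\<lambda>x. \<theta> * (a * (low g h x / g x) + high \<phi> h x / g x)"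
    have "(?R \<longlongrightarrow> \<theta> * (a * cdf M h + L h)) at_top"
      by (intro tendsto_intros low_g_limit high h)
    then have "\<forall>\<^sub>F x in at_top. \<theta> * (a + Ls) - e < ?R x"
      using e by (rule order_tendstoD)
    then have "\<forall>\<^sub>F x in at_top. (\<theta> * (a + Ls) - e) * g x \<le> \<phi> x"
      using eventually_ge_at_top[of "2 * h"] eventually_ge_at_top[of "X + h"] g_eventually_pos
    proof eventually_elim
      case (elim x)
      have "(\<integral>y. a * (indicator {..h} y * g (x - y)) \<partial>M) \<le> low \<phi> h x"
        unfolding low_def using X elim
        by (intro integral_mono int_ind integrable_mult_right integrable_indicator_mult integrable_g)
           (auto split: split_indicator)
      then have low: "a * low g h x \<le> low \<phi> h x" by (simp add: low_def)
      have "(\<theta> * (a + Ls) - e) * g x \<le> ?R x * g x"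
        using elim by (intro mult_right_mono) auto
      also have "\<dots> = \<theta> * (a * low g h x + high \<phi> h x)"
        using elim by (simp add: field_simps)
      also have "\<dots> \<le> \<theta> * (low \<phi> h x + mid \<phi> h x + high \<phi> h x)"
        using low mid_nonneg[of h x] \<theta> by (intro mult_left_mono) auto
      also have "\<dots> = \<phi> x"
        using integral_split[OF int elim(2)] rec[of x] elim h by simp
      finally show ?case .
    qed
    with that show ?thesis by (simp add: V_def)
  qed

  define c where "c = \<theta> * Ls / (1 - \<theta>)"
  have c: "c > 0" using \<theta> L0 L_le_Ls[of 0] by (simp add: c_def)
  \<comment> \<open>Real infima and suprema are meaningful only for nonempty bounded sets:
    \<open>U\<close> contains \<open>B\<close> and is bounded below by 0, \<open>V\<close> contains
    0 and is bounded above by \<open>B\<close>.\<close>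
  have "U B" using eventually_mono[OF eventually_ge_at_top[of x1] bound] B by (simp add: U_def)
  have "V 0" using \<phi>_nonneg by (simp add: V_def)
  have V_le: "a \<le> B" if "V a" for a
  proof -
    have "\<forall>\<^sub>F x in at_top. a * g x \<le> \<phi> x \<and> \<phi> x \<le> B * g x \<and> 0 < g x"
      using that \<open>U B\<close> g_eventually_pos unfolding U_def V_def
      by (intro eventually_conj) blast+
    then obtain x where x: "a * g x \<le> \<phi> x" "\<phi> x \<le> B * g x" "0 < g x"
      unfolding eventually_at_top_linorder by blast
    then have "a * g x \<le> B * g x" by linarith
    with x show ?thesis by simp
  qed
  have bddU: "bdd_below {b. U b}" by (rule bdd_belowI[of _ 0]) (auto simp: U_def)
  have bddV: "bdd_above {a. V a}" by (rule bdd_aboveI[of _ B]) (auto simp: V_le)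
  have "Inf {b. U b} \<le> c"
  proof -
    let ?s = "Inf {b. U b}"
    \<comment> \<open>Letting the error in \<open>U_step\<close> tend to 0 and then taking the
      infimum over \<open>b\<close> gives \<open>?s \<le> \<theta> * (?s + Ls)\<close>, that is,
      \<open>?s \<le> c\<close>.\<close>
    have step: "?s \<le> \<theta> * (b + Ls)" if "U b" for b
      by (rule field_le_epsilon, rule cInf_lower[OF _ bddU]) (use U_step[OF that] in simp)
    have "?s / \<theta> - Ls \<le> b" if "U b" for b
      using step[OF that] \<theta> by (simp add: field_simps)
    then have "?s / \<theta> - Ls \<le> ?s" using \<open>U B\<close> by (intro cInf_greatest) auto
    then show ?thesis using \<theta> by (simp add: c_def field_simps)
  qed
  have "c \<le> Sup {a. V a}"
  proof -
    let ?s = "Sup {a. V a}"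
    have s0: "0 \<le> ?s" using \<open>V 0\<close> by (intro cSup_upper[OF _ bddV]) auto
    have step: "\<theta> * (a + Ls) \<le> ?s" if "V a" for a
    proof (rule field_le_epsilon)
      fix e :: real assume "e > 0"
      show "\<theta> * (a + Ls) \<le> ?s + e"
      \<comment> \<open>\<open>V\<close> admits only nonnegative constants; if the improved one is
        negative, \<open>0 \<le> ?s\<close> suffices.\<close>
      proof (cases "0 \<le> \<theta> * (a + Ls) - e")
        case True
        then have "\<theta> * (a + Ls) - e \<le> ?s"
          using V_step[OF that \<open>e > 0\<close>] by (intro cSup_upper[OF _ bddV]) auto
        then show ?thesis by simp
      qed (use s0 in simp)
    qed
    have "a \<le> ?s / \<theta> - Ls" if "V a" for a
      using step[OF that] \<theta> by (simp add: field_simps)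
    then have "?s \<le> ?s / \<theta> - Ls" using \<open>V 0\<close> by (intro cSup_least) auto
    then show ?thesis using \<theta> by (simp add: c_def field_simps)
  qed
  have "((\<lambda>x. \<phi> x / g x) \<longlongrightarrow> c) at_top"
  proof (rule order_tendstoI)
    fix u assume "c < u"
    with \<open>Inf {b. U b} \<le> c\<close> have "Inf {b. U b} < u" by simp
    then obtain b where b: "U b" "b < u"
      using cInf_less_iff[OF _ bddU, of u] \<open>U B\<close> by auto
    show "\<forall>\<^sub>F x in at_top. \<phi> x / g x < u"
      using b(1)[unfolded U_def, THEN conjunct2] g_eventually_pos
    proof eventually_elim
      case (elim x)
      then have "\<phi> x / g x \<le> b" by (simp add: field_simps)
      with b show ?case by simp
    qed
  next
    fix u assume "u < c"
    with \<open>c \<le> Sup {a. V a}\<close> have "u < Sup {a. V a}" by simp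
    then obtain a where a: "V a" "u < a"
      using less_cSup_iff[OF _ bddV, of u] \<open>V 0\<close> by auto
    show "\<forall>\<^sub>F x in at_top. u < \<phi> x / g x"
      using a(1)[unfolded V_def, THEN conjunct2] g_eventually_pos
    proof eventually_elim
      case (elim x)
      then have "a \<le> \<phi> x / g x" by (simp add: field_simps)
      with a show ?case by simp
    qed
  qed
  with c show ?thesis by (rule that)
qed

end

subsection \<open>The maximum of a multiplicative walk\<close>

lemma elog_mult: "0 \<le> a \<Longrightarrow> 0 \<le> b \<Longrightarrow> elog (a * b) = elog a + elog b"
  by (auto simp: elog_def ln_mult mult_le_0_iff)

lemma less_elog_iff: "ereal x < elog a \<longleftrightarrow> exp x < a"
proof (cases "a > 0")
  case True
  then show ?thesis using ln_less_cancel_iff[of "exp x" a] by (simp add: elog_def)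
next
  case False
  then show ?thesis using exp_gt_zero[of x] by (simp add: elog_def del: exp_gt_zero)
qed

text \<open>\<open>elog\<close> sends negative arguments to \<open>- \<infinity>\<close>, so cutting
  the factors off at 0 changes nothing and makes the identity hold at every point instead of almost
  surely.\<close>

lemma log_walk_eq_elog_prod: "log_walk As n \<omega> = elog (\<Prod>i=1..n. max 0 (As i \<omega>))"
proof (induction n)
  case 0
  then show ?case by (simp add: log_walk_def elog_def zero_ereal_def)
next
  case (Suc n)
  have "elog (As (Suc n) \<omega>) = elog (max 0 (As (Suc n) \<omega>))"
    by (auto simp: elog_def)
  moreover have "log_walk As (Suc n) \<omega> = log_walk As n \<omega> + elog (As (Suc n) \<omega>)"
    by (simp add: log_walk_def)
  ultimately show ?case
    using Suc by (simp add: elog_mult prod_nonneg)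
qed

text \<open>\<open>prod_max x n j\<close> is the maximum of the products \<open>x (j + 1) \<cdots> x (j + k)\<close> with \<open>k \<le> n\<close>, the
  exponential of the maximum of a walk started at time \<open>j\<close>.\<close>

primrec prod_max :: "(nat \<Rightarrow> real) \<Rightarrow> nat \<Rightarrow> nat \<Rightarrow> real" where
  "prod_max x 0 j = 1"
| "prod_max x (Suc n) j = max 1 (x (Suc j) * prod_max x n (Suc j))"

lemma prod_max_ge_1: "prod_max x n j \<ge> 1"
  by (cases n) auto

text \<open>Induction peels off the leading factor, \<open>k = 0\<close> being the empty product 1.
  A positive factor is divided out of the comparison; a zero factor annihilates all longer
  products.\<close>

lemma less_prod_max_iff:
  assumes "\<And>i. 0 \<le> x i"
  shows "s < prod_max x n j \<longleftrightarrow> (\<exists>k\<le>n. s < (\<Prod>i=Suc j..j + k. x i))"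
proof (induction n arbitrary: s j)
  case 0
  then show ?case by simp
next
  case (Suc n)
  have split: "(\<exists>k\<le>Suc n. s < (\<Prod>i=Suc j..j + k. x i)) \<longleftrightarrow>
    s < 1 \<or> (\<exists>k\<le>n. s < x (Suc j) * (\<Prod>i=Suc (Suc j)..Suc j + k. x i))"
  proof -
    have "(\<Prod>i=Suc j..j + Suc k. x i) = x (Suc j) * (\<Prod>i=Suc (Suc j)..Suc j + k. x i)" for k
      by (subst prod.atLeast_Suc_atMost) auto
    moreover have "(\<exists>k\<le>Suc n. P k) \<longleftrightarrow> P 0 \<or> (\<exists>k\<le>n. P (Suc k))" for P
      by (metis Suc_le_mono le0 not0_implies_Suc)
    ultimately show ?thesis by simp
  qed
  show ?case
  proof (cases "x (Suc j) > 0")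
    case True
    have "s < x (Suc j) * p \<longleftrightarrow> s / x (Suc j) < p" for p
      using True by (simp add: pos_divide_less_eq mult.commute)
    then show ?thesis unfolding split by (auto simp: Suc less_max_iff_disj)
  next
    case False
    then have "x (Suc j) = 0" using assms[of "Suc j"] by simp
    then show ?thesis unfolding split by (auto simp: less_max_iff_disj)
  qed
qed

lemma prod_max_mono:
  assumes "\<And>i. 0 \<le> x i" "m \<le> n"
  shows "prod_max x m j \<le> prod_max x n j"
proof (rule ccontr)
  assume "\<not> prod_max x m j \<le> prod_max x n j"
  then have "prod_max x n j < prod_max x m j" by simp
  from less_prod_max_iff[where x=x, OF assms(1), THEN iffD1, OF this]
  obtain k where "k \<le> m" "prod_max x n j < (\<Prod>i=Suc j..j + k. x i)" by blast
  then have "prod_max x n j < prod_max x n j"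
    using assms(2) less_prod_max_iff[where x=x, OF assms(1), of "prod_max x n j" n j]
    by (auto intro!: exI[of _ k])
  then show False by simp
qed

lemma prod_max_cong:
  "(\<And>i. j < i \<Longrightarrow> i \<le> j + n \<Longrightarrow> x i = y i) \<Longrightarrow> prod_max x n j = prod_max y n j"
  by (induction n arbitrary: j) auto

lemma borel_measurable_prod_max:
  assumes "\<And>i. j < i \<Longrightarrow> i \<le> j + n \<Longrightarrow> (\<lambda>\<omega>. X \<omega> i) \<in> borel_measurable N"
  shows "(\<lambda>\<omega>. prod_max (X \<omega>) n j) \<in> borel_measurable N"
  using assms
proof (induction n arbitrary: j)
  case (Suc n)
  have "(\<lambda>\<omega>. prod_max (X \<omega>) n (Suc j)) \<in> borel_measurable N"
    using Suc by simp
  moreover have "(\<lambda>\<omega>. X \<omega> (Suc j)) \<in> borel_measurable N"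
    using Suc.prems by simp
  ultimately show ?case by simp
qed simp

lemma less_walk_max_iff:
  "ereal x < walk_max As \<omega> \<longleftrightarrow> (\<exists>n. exp x < prod_max (\<lambda>i. max 0 (As i \<omega>)) n 0)"
proof -
  have *: "(\<exists>n. exp x < prod_max (\<lambda>i. max 0 (As i \<omega>)) n 0) \<longleftrightarrow>
      (\<exists>n. ereal x < log_walk As n \<omega>)"
    by (subst less_prod_max_iff) (auto simp: log_walk_eq_elog_prod less_elog_iff)
  \<comment> \<open>The 0 in \<open>walk_max\<close> is the walk at time 0, which corresponds to the
    empty product.\<close>
  have "log_walk As 0 \<omega> = 0" by (simp add: log_walk_def)
  then have "(\<exists>n. ereal x < log_walk As n \<omega>) \<longleftrightarrow> ereal x < 0 \<or> (\<exists>n\<ge>1. ereal x < log_walk As n \<omega>)"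
    by (metis One_nat_def less_one not_le)
  then show ?thesis
    unfolding * walk_max_def by (auto simp: less_max_iff_disj less_SUP_iff)
qed

context prob_space
begin

text \<open>Conditioning on \<open>X\<close> through the product of the two laws. Where
  \<open>X\<close> is 0 the event would need \<open>s < 0\<close>, so only \<open>a > 0\<close>
  contributes.\<close>

lemma prob_mult_gt:
  fixes X W :: "'a \<Rightarrow> real"
  assumes ind: "indep_var borel X borel W" and X: "\<And>\<omega>. 0 \<le> X \<omega>" and s: "0 \<le> s"
  shows "prob {\<omega> \<in> space M. s < X \<omega> * W \<omega>} =
    (\<integral>a. (if 0 < a then prob {\<omega> \<in> space M. s / a < W \<omega>} else 0) \<partial>distr M borel X)"
proof -
  have rv [measurable]: "X \<in> borel_measurable M" "W \<in> borel_measurable M"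
    using indep_var_rv1[OF ind] indep_var_rv2[OF ind] by auto
  interpret X: prob_space "distr M borel X" by (rule prob_space_distr) simp
  interpret W: prob_space "distr M borel W" by (rule prob_space_distr) simp
  interpret XW: pair_prob_space "distr M borel X" "distr M borel W" ..
  let ?f = "\<lambda>(a, w). indicator {p. s < fst p * snd p} (a, w) :: real"
  have [measurable]: "{p. s < fst p * snd p} \<in> sets (borel \<Otimes>\<^sub>M borel)"
  proof -
    have "{p \<in> space (borel \<Otimes>\<^sub>M borel). s < fst p * snd p} \<in> sets (borel \<Otimes>\<^sub>M (borel :: real measure))"
      by measurable
    then show ?thesis by (simp add: space_pair_measure)
  qed
  have "prob {\<omega> \<in> space M. s < X \<omega> * W \<omega>} = (\<integral>\<omega>. ?f (X \<omega>, W \<omega>) \<partial>M)"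
    by (subst Bochner_Integration.integral_cong[OF refl, where g="indicator {\<omega> \<in> space M. s < X \<omega> * W \<omega>}"])
       (auto split: split_indicator intro!: arg_cong[where f=prob])
  also have "\<dots> = (\<integral>p. ?f p \<partial>distr M (borel \<Otimes>\<^sub>M borel) (\<lambda>\<omega>. (X \<omega>, W \<omega>)))"
    by (subst integral_distr) auto
  also have "\<dots> = (\<integral>p. ?f p \<partial>(distr M borel X \<Otimes>\<^sub>M distr M borel W))"
    using ind by (simp add: indep_var_distribution_eq)
  also have "\<dots> = (\<integral>a. (\<integral>w. ?f (a, w) \<partial>distr M borel W) \<partial>distr M borel X)"
    by (rule XW.integral_fst'[symmetric], rule XW.integrable_const_bound[where B=1]) auto
  also have "\<dots> = (\<integral>a. (if 0 < a then prob {\<omega> \<in> space M. s / a < W \<omega>} else 0) \<partial>distr M borel X)"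
  proof (rule Bochner_Integration.integral_cong_AE)
    show "AE a in distr M borel X. (\<integral>w. ?f (a, w) \<partial>distr M borel W) =
        (if 0 < a then prob {\<omega> \<in> space M. s / a < W \<omega>} else 0)"
    \<comment> \<open>Passing back to the points \<open>X \<omega>\<close> excludes negative
      \<open>a\<close>, where the integrands can differ.\<close>
    proof (subst AE_distr_iff)
      show "AE \<omega> in M. (\<integral>w. ?f (X \<omega>, w) \<partial>distr M borel W) =
        (if 0 < X \<omega> then prob {\<omega>' \<in> space M. s / X \<omega> < W \<omega>'} else 0)"
      proof (rule AE_I2)
        fix \<omega>
        show "(\<integral>w. ?f (X \<omega>, w) \<partial>distr M borel W) =
          (if 0 < X \<omega> then prob {\<omega>' \<in> space M. s / X \<omega> < W \<omega>'} else 0)"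
        proof (cases "X \<omega> > 0")
          case True
          have "(\<integral>w. ?f (X \<omega>, w) \<partial>distr M borel W) = (\<integral>w. indicator {s / X \<omega><..} w \<partial>distr M borel W)"
            using True by (intro Bochner_Integration.integral_cong refl)
              (auto split: split_indicator simp: field_simps)
          also have "\<dots> = prob {\<omega>' \<in> space M. s / X \<omega> < W \<omega>'}"
            by (simp add: measure_distr) (auto intro!: arg_cong[where f=prob])
          finally show ?thesis using True by simp
        next
          case False
          then have "X \<omega> = 0" using X[of \<omega>] by simp
          then show ?thesis using s by simp
        qed
      qed
    qed measurable
  qed measurable
  finally show ?thesis .
qed

end

subsection \<open>The tilted law\<close>

text \<open>\<open>interval_measure\<close> recovers the law from its distribution function, and
  conditioning on one summand turns the convolution into an integral of shifted distribution
  functions.\<close>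

lemma (in real_distribution) incr_self_convolution:
  "incr T (self_convolution (cdf M)) x = (\<integral>y. incr T (cdf M) (x - y) \<partial>M)"
proof -
  have eq: "interval_measure (cdf M) = M"
  proof (rule cdf_unique)
    show "real_distribution (interval_measure (cdf M))"
      by (intro real_distribution_interval_measure cdf_nondecreasing cdf_is_right_cont
          cdf_lim_at_top_prob cdf_lim_at_bot)
    show "cdf (interval_measure (cdf M)) = cdf M"
      by (intro cdf_interval_measure cdf_nondecreasing cdf_is_right_cont cdf_lim_at_bot)
  qed (rule real_distribution_axioms)
  have int: "integrable M (\<lambda>y. cdf M (x - y))" for x
    by (intro integrable_const_bound[where B=1]) (auto simp: cdf_nonneg cdf_bounded_prob)
  have "cdf (M \<star> M) x = (\<integral>y. cdf M (x - y) \<partial>M)" for x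
  proof -
    have "{y. y + z \<in> {..x}} = {..x - z}" for z by auto
    then have "emeasure (M \<star> M) {..x} = (\<integral>\<^sup>+ z. ennreal (cdf M (x - z)) \<partial>M)"
      using finite_measure_axioms
      by (subst convolution_emeasure) (auto simp: cdf_def emeasure_eq_measure)
    also have "\<dots> = ennreal (\<integral>z. cdf M (x - z) \<partial>M)"
      by (intro nn_integral_eq_integral int) (auto simp: cdf_nonneg)
    finally show ?thesis
      by (simp add: cdf_def measure_def integral_nonneg_AE)
  qed
  then show ?thesis
    using Bochner_Integration.integral_diff[OF int int, of "x + T" x]
    by (simp add: self_convolution_def eq incr_def add_diff_eq diff_add_eq)
qed

lemma dominated_subexponentialI:
  assumes \<nu>: "real_distribution \<nu>" and loc: "locally_subexponential (cdf \<nu>)"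
    and dom: "\<exists>K x0. \<forall>x\<ge>x0. (SUP y\<in>{x<..}. incr 1 (cdf \<nu>) y) \<le> K * incr 1 (cdf \<nu>) x"
  obtains K x0 where "dominated_subexponential \<nu> K x0"
proof -
  interpret real_distribution \<nu> by fact
  from dom obtain K x1 where K: "\<And>x. x \<ge> x1 \<Longrightarrow> (SUP y\<in>{x<..}. incr 1 (cdf \<nu>) y) \<le> K * incr 1 (cdf \<nu>) x"
    by blast
  have sub: "delta_subexponential T (cdf \<nu>)" if "T > 0" for T
    using loc that by (simp add: locally_subexponential_def)
  have pos: "\<forall>\<^sub>F x in at_top. incr T (cdf \<nu>) x > 0" if "T > 0" for T
    using sub[OF that] by (simp add: delta_subexponential_def)
  obtain x2 where x2: "\<And>x. x \<ge> x2 \<Longrightarrow> incr 1 (cdf \<nu>) x > 0"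
    using pos[of 1] by (auto simp: eventually_at_top_linorder)
  show ?thesis
  \<comment> \<open>The hypothesis bounds only \<open>y > x\<close>; \<open>max K 1\<close> also
    covers \<open>y = x\<close>.\<close>
  proof (rule that[of "max K 1" "max x1 x2"], unfold_locales)
    fix T :: real assume "T > 0"
    then show "\<forall>\<^sub>F x in at_top. incr T (cdf \<nu>) x > 0" by (rule pos)
    fix t :: real assume t: "t \<in> {0..1}"
    have "uniform_limit {0..1} (\<lambda>x t. incr T (cdf \<nu>) (x + t) / incr T (cdf \<nu>) x) (\<lambda>_. 1) at_top"
      using sub[OF \<open>T > 0\<close>] by (simp add: delta_subexponential_def delta_long_tailed_def)
    from tendsto_uniform_limitI[OF this t]
    show "((\<lambda>x. incr T (cdf \<nu>) (x + t) / incr T (cdf \<nu>) x) \<longlongrightarrow> 1) at_top" .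
  next
    have "incr 1 (self_convolution (cdf \<nu>)) \<sim>[at_top] (\<lambda>x. 2 * incr 1 (cdf \<nu>) x)"
      using sub[of 1] by (simp add: delta_subexponential_def)
    then have "(\<lambda>x. \<integral>y. incr 1 (cdf \<nu>) (x - y) \<partial>\<nu>) \<sim>[at_top] (\<lambda>x. 2 * incr 1 (cdf \<nu>) x)"
      by (simp add: incr_self_convolution[abs_def])
    then have "((\<lambda>x. (\<integral>y. incr 1 (cdf \<nu>) (x - y) \<partial>\<nu>) / (2 * incr 1 (cdf \<nu>) x)) \<longlongrightarrow> 1) at_top"
      by (rule asymp_equivD_strong) (use pos[of 1] in \<open>auto elim!: eventually_mono\<close>)
    from tendsto_mult_left[OF this, of 2]
    show "((\<lambda>x. (\<integral>y. incr 1 (cdf \<nu>) (x - y) \<partial>\<nu>) / incr 1 (cdf \<nu>) x) \<longlongrightarrow> 2) at_top"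
      by simp
  next
    fix x :: real assume x: "x \<ge> max x1 x2"
    then show p: "incr 1 (cdf \<nu>) x > 0" by (intro x2) simp
    fix y assume "y \<ge> x"
    show "incr 1 (cdf \<nu>) y \<le> max K 1 * incr 1 (cdf \<nu>) x"
    proof (cases "y = x")
      case False
      \<comment> \<open>A real \<open>SUP\<close> is known to be an upper bound only for a bounded
        set; increments are at most 1.\<close>
      have "bdd_above (incr 1 (cdf \<nu>) ` {x<..})"
      proof (rule bdd_aboveI2)
        fix z show "incr 1 (cdf \<nu>) z \<le> 1"
          using cdf_nonneg[of z] cdf_bounded_prob[of "z + 1"] by (simp add: incr_def)
      qed
      then have "incr 1 (cdf \<nu>) y \<le> (SUP y\<in>{x<..}. incr 1 (cdf \<nu>) y)"
        using False \<open>y \<ge> x\<close> by (intro cSUP_upper) auto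
      also have "\<dots> \<le> K * incr 1 (cdf \<nu>) x" using K x by simp
      also have "\<dots> \<le> max K 1 * incr 1 (cdf \<nu>) x" using p by (intro mult_right_mono) auto
      finally show ?thesis .
    qed (use p in \<open>simp add: mult_le_cancel_right1\<close>)
  qed
qed

text \<open>The junk value of \<open>ln\<close> at \<open>0\<close> is harmless, since the density vanishes where \<open>A = 0\<close>.\<close>

definition tilted_law :: "'a measure \<Rightarrow> ('a \<Rightarrow> real) \<Rightarrow> real \<Rightarrow> real measure" where
  "tilted_law M A \<kappa> = distr (density M (\<lambda>\<omega>. ennreal (A \<omega> powr \<kappa> / moment M A \<kappa>))) borel (\<lambda>\<omega>. ln (A \<omega>))"

context
  fixes M :: "'a measure" and A :: "'a \<Rightarrow> real" and \<kappa> :: real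
  assumes M: "prob_space M" and A [measurable]: "A \<in> borel_measurable M"
    and A_nonneg: "AE \<omega> in M. 0 \<le> A \<omega>"
    and integrable_powr: "integrable M (\<lambda>\<omega>. A \<omega> powr \<kappa>)" and moment_pos: "0 < moment M A \<kappa>"
begin

lemma integral_tilted_law:
  assumes [measurable]: "h \<in> borel_measurable borel"
  shows "(\<integral>y. h y \<partial>tilted_law M A \<kappa>) = (\<integral>\<omega>. A \<omega> powr \<kappa> / moment M A \<kappa> * h (ln (A \<omega>)) \<partial>M)"
  unfolding tilted_law_def using moment_pos
  by (subst integral_distr, simp, simp, subst integral_density) auto

lemma integrable_tilted_law_iff:
  assumes [measurable]: "h \<in> borel_measurable borel"
  shows "integrable (tilted_law M A \<kappa>) h \<longleftrightarrow> integrable M (\<lambda>\<omega>. A \<omega> powr \<kappa> / moment M A \<kappa> * h (ln (A \<omega>)))"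
  unfolding tilted_law_def using moment_pos
  by (subst integrable_distr_eq, simp, simp, subst integrable_density) auto

lemma real_distribution_tilted_law: "real_distribution (tilted_law M A \<kappa>)"
proof -
  have "(\<integral>\<^sup>+\<omega>. ennreal (A \<omega> powr \<kappa> / moment M A \<kappa>) \<partial>M) = ennreal (\<integral>\<omega>. A \<omega> powr \<kappa> / moment M A \<kappa> \<partial>M)"
    using integrable_powr moment_pos by (intro nn_integral_eq_integral) auto
  also have "\<dots> = 1" using moment_pos by (simp add: moment_def)
  finally have "prob_space (density M (\<lambda>\<omega>. ennreal (A \<omega> powr \<kappa> / moment M A \<kappa>)))"
    by (intro prob_spaceI) (simp add: emeasure_density cong: nn_integral_cong)
  then show ?thesis
    unfolding tilted_law_def by (intro prob_space.real_distribution_distr) auto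
qed

lemma cdf_tilted_law: "cdf (tilted_law M A \<kappa>) = tilted_cdf M A \<kappa>"
proof
  fix x
  have "cdf (tilted_law M A \<kappa>) x = (\<integral>y. indicator {..x} y \<partial>tilted_law M A \<kappa>)"
    by (simp add: cdf_def tilted_law_def)
  also have "\<dots> = (\<integral>\<omega>. A \<omega> powr \<kappa> / moment M A \<kappa> * indicator {..x} (ln (A \<omega>)) \<partial>M)"
    by (subst integral_tilted_law) auto
  also have "\<dots> = (\<integral>\<omega>. inverse (moment M A \<kappa>) * (indicator {\<omega>. elog (A \<omega>) \<le> ereal x} \<omega> * A \<omega> powr \<kappa>) \<partial>M)"
  proof (rule Bochner_Integration.integral_cong_AE)
    have *: "elog (A \<omega>) \<le> ereal x \<longleftrightarrow> A \<omega> \<le> 0 \<or> ln (A \<omega>) \<le> x" for \<omega> by (auto simp: elog_def)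
    show "(\<lambda>\<omega>. inverse (moment M A \<kappa>) * (indicator {\<omega>. elog (A \<omega>) \<le> ereal x} \<omega> * A \<omega> powr \<kappa>)) \<in> borel_measurable M"
      unfolding * indicator_def by measurable
    show "AE \<omega> in M. A \<omega> powr \<kappa> / moment M A \<kappa> * indicator {..x} (ln (A \<omega>)) =
        inverse (moment M A \<kappa>) * (indicator {\<omega>. elog (A \<omega>) \<le> ereal x} \<omega> * A \<omega> powr \<kappa>)"
      using A_nonneg by eventually_elim (auto simp: * field_simps split: split_indicator)
  qed measurable
  also have "\<dots> = tilted_cdf M A \<kappa> x"
    by (simp add: tilted_cdf_def)
  finally show "cdf (tilted_law M A \<kappa>) x = tilted_cdf M A \<kappa> x" .
qed

text \<open>A change of measure: \<open>A powr \<kappa>\<close> cancels against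
  \<open>exp (- \<kappa> * ln A)\<close>. For \<open>q\<close> the tail of the maximum, the integral
  on the right is the probability that \<open>log A\<close> plus an independent copy of the maximum
  exceeds \<open>x\<close>, so the recursion becomes a convolution equation with factor
  \<open>\<theta>\<close>.\<close>

lemma tilt_identity:
  assumes [measurable]: "q \<in> borel_measurable borel"
  shows "moment M A \<kappa> * (\<integral>y. exp (\<kappa> * (x - y)) * q (x - y) \<partial>tilted_law M A \<kappa>) =
    exp (\<kappa> * x) * (\<integral>\<omega>. (if 0 < A \<omega> then q (x - ln (A \<omega>)) else 0) \<partial>M)"
proof -
  have "moment M A \<kappa> * (\<integral>y. exp (\<kappa> * (x - y)) * q (x - y) \<partial>tilted_law M A \<kappa>) =
      (\<integral>\<omega>. moment M A \<kappa> * (A \<omega> powr \<kappa> / moment M A \<kappa> * (exp (\<kappa> * (x - ln (A \<omega>))) * q (x - ln (A \<omega>)))) \<partial>M)"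
    by (subst integral_tilted_law) auto
  also have "\<dots> = (\<integral>\<omega>. exp (\<kappa> * x) * (if 0 < A \<omega> then q (x - ln (A \<omega>)) else 0) \<partial>M)"
  proof (rule Bochner_Integration.integral_cong_AE)
    show "AE \<omega> in M. moment M A \<kappa> * (A \<omega> powr \<kappa> / moment M A \<kappa> * (exp (\<kappa> * (x - ln (A \<omega>))) * q (x - ln (A \<omega>))))
        = exp (\<kappa> * x) * (if 0 < A \<omega> then q (x - ln (A \<omega>)) else 0)"
      using A_nonneg
    proof eventually_elim
      case (elim \<omega>)
      show ?case
      proof (cases "A \<omega> > 0")
        case True
        have "A \<omega> powr \<kappa> * exp (\<kappa> * (x - ln (A \<omega>))) = exp (\<kappa> * x)"
          using True by (simp add: powr_def algebra_simps flip: exp_add)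
        then show ?thesis using True moment_pos by simp
      qed (use elim in auto)
    qed
  qed measurable
  finally show ?thesis by simp
qed

text \<open>The tilt undoes the exponential, leaving \<open>P (A \<noteq> 0) / \<theta>\<close>.
  This makes \<open>exp (\<kappa> * (x - y)) * q (x - y)\<close> integrable in \<open>y\<close> for
  every measurable \<open>q\<close> with values in \<open>[0, 1]\<close>.\<close>

lemma integrable_exp_tilted_law: "integrable (tilted_law M A \<kappa>) (\<lambda>y. exp (- \<kappa> * y))"
proof (subst integrable_tilted_law_iff)
  interpret prob_space M by (rule M)
  show "integrable M (\<lambda>\<omega>. A \<omega> powr \<kappa> / moment M A \<kappa> * exp (- \<kappa> * ln (A \<omega>)))"
  proof (rule integrable_const_bound[where B="1 / moment M A \<kappa>"])
    have "A \<omega> powr \<kappa> * exp (- \<kappa> * ln (A \<omega>)) \<le> 1" for \<omega>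
      by (simp add: powr_def flip: exp_add)
    then show "AE \<omega> in M. norm (A \<omega> powr \<kappa> / moment M A \<kappa> * exp (- \<kappa> * ln (A \<omega>))) \<le> 1 / moment M A \<kappa>"
      using moment_pos by (intro AE_I2) (simp add: abs_mult divide_right_mono)
  qed measurable
qed measurable

end

subsection \<open>The recursion for the maximum\<close>

context prob_space
begin

text \<open>The first factor and the maximum started one step later depend on disjoint blocks of
  coordinates, hence are independent; as \<open>1 \<le> s\<close>, the 1 in the maximum never
  exceeds \<open>s\<close>.\<close>

lemma prob_less_prod_max_Suc:
  fixes X :: "nat \<Rightarrow> 'a \<Rightarrow> real"
  assumes ind: "indep_vars (\<lambda>_. borel) X {1..}" and nonneg: "\<And>i \<omega>. 0 \<le> X i \<omega>"
    and distr: "\<And>i. i \<ge> 1 \<Longrightarrow> distr M borel (X i) = D" and s: "1 \<le> s"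
  shows "prob {\<omega> \<in> space M. s < prod_max (\<lambda>i. X i \<omega>) (Suc n) j} =
    (\<integral>a. (if 0 < a then prob {\<omega> \<in> space M. s / a < prod_max (\<lambda>i. X i \<omega>) n (Suc j)} else 0) \<partial>D)"
proof -
  let ?I = "{Suc j<..Suc j + n}" and ?W = "\<lambda>\<omega>. prod_max (\<lambda>i. X i \<omega>) n (Suc j)"
  have "indep_var (PiM {Suc j} (\<lambda>_. borel)) (\<lambda>\<omega>. restrict (\<lambda>i. X i \<omega>) {Suc j})
      (PiM ?I (\<lambda>_. borel)) (\<lambda>\<omega>. restrict (\<lambda>i. X i \<omega>) ?I)"
    by (rule indep_var_restrict[OF ind]) auto
  then have "indep_var borel ((\<lambda>x. x (Suc j)) \<circ> (\<lambda>\<omega>. restrict (\<lambda>i. X i \<omega>) {Suc j}))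
      borel ((\<lambda>x. prod_max x n (Suc j)) \<circ> (\<lambda>\<omega>. restrict (\<lambda>i. X i \<omega>) ?I))"
    by (rule indep_var_compose) (auto intro!: borel_measurable_prod_max)
  moreover have "(\<lambda>x. prod_max x n (Suc j)) \<circ> (\<lambda>\<omega>. restrict (\<lambda>i. X i \<omega>) ?I) = ?W"
    by (auto simp: fun_eq_iff intro!: prod_max_cong)
  ultimately have "indep_var borel (X (Suc j)) borel ?W"
    by (simp add: comp_def)
  from prob_mult_gt[OF this nonneg, of s]
  have "prob {\<omega> \<in> space M. s < X (Suc j) \<omega> * ?W \<omega>} =
    (\<integral>a. (if 0 < a then prob {\<omega> \<in> space M. s / a < ?W \<omega>} else 0) \<partial>D)"
    using s distr[of "Suc j"] by simp
  then show ?thesis using s by (simp add: less_max_iff_disj)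
qed

text \<open>The recursion depends on \<open>j\<close> only through the maximum with the shorter
  horizon, so induction applies. Below \<open>s = 1\<close> both events are certain.\<close>

lemma prob_less_prod_max_shift:
  fixes X :: "nat \<Rightarrow> 'a \<Rightarrow> real"
  assumes ind: "indep_vars (\<lambda>_. borel) X {1..}" and nonneg: "\<And>i \<omega>. 0 \<le> X i \<omega>"
    and distr: "\<And>i. i \<ge> 1 \<Longrightarrow> distr M borel (X i) = D"
  shows "prob {\<omega> \<in> space M. s < prod_max (\<lambda>i. X i \<omega>) n j} = prob {\<omega> \<in> space M. s < prod_max (\<lambda>i. X i \<omega>) n 0}"
proof (induction n arbitrary: s j)
  case (Suc n)
  show ?case
  proof (cases "s \<ge> 1")
    case True
    then show ?thesis
      using prob_less_prod_max_Suc[OF ind nonneg distr True, of n j]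
        prob_less_prod_max_Suc[OF ind nonneg distr True, of n 0] Suc.IH[of _ "Suc j"] Suc.IH[of _ "Suc 0"]
      by (simp cong: if_cong del: prod_max.simps)
  next
    case False
    then have "s < prod_max x (Suc n) j" for x j
      using prod_max_ge_1[of x "Suc n" j] by linarith
    then show ?thesis by (simp del: prod_max.simps)
  qed
qed simp

end

theorem corollary1:
  fixes M :: "'a measure" and A :: "'a \<Rightarrow> real" and As :: "nat \<Rightarrow> 'a \<Rightarrow> real" and \<kappa> :: real
  assumes "prob_space M"
    and "A \<in> borel_measurable M"
    and "AE \<omega> in M. 0 \<le> A \<omega>"
    and "\<not> (AE \<omega> in M. A \<omega> = 1)"
    and "\<kappa> > 0"
    and "integrable M (\<lambda>\<omega>. A \<omega> powr \<kappa>)"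
    and "0 < moment M A \<kappa>" and "moment M A \<kappa> < 1"
    and "locally_subexponential (tilted_cdf M A \<kappa>)"
    and "\<exists>K x0. \<forall>x\<ge>x0. (SUP y\<in>{x<..}. incr 1 (tilted_cdf M A \<kappa>) y) \<le> K * incr 1 (tilted_cdf M A \<kappa>) x"
    and "nonarithmetic (log_law_given_nonzero M A)"
    and "prob_space.indep_vars M (\<lambda>_. borel) As {1..}"
    and "\<And>n. n \<ge> 1 \<Longrightarrow> distr M borel (As n) = distr M borel A"
  shows "\<exists>c>0. (\<lambda>x. measure M {\<omega> \<in> space M. walk_max As \<omega> > ereal x})
           \<sim>[at_top] (\<lambda>x. c * (tilted_cdf M A \<kappa> (x + 1) - tilted_cdf M A \<kappa> x) * exp (- \<kappa> * x))"
proof -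
  interpret prob_space M by fact
  note A_meas [measurable] = assms(2) and \<kappa> = assms(5)
  note hyps = assms(1,2,3,6,7)

  \<comment> \<open>Passage to the tilted law\<close>
  define \<theta> where "\<theta> = moment M A \<kappa>"
  have \<theta>: "0 < \<theta>" "\<theta> < 1" using assms(7,8) by (auto simp: \<theta>_def)
  define \<nu> where "\<nu> = tilted_law M A \<kappa>"
  have cdf: "tilted_cdf M A \<kappa> = cdf \<nu>"
    unfolding \<nu>_def by (rule cdf_tilted_law[OF hyps, symmetric])
  have \<nu>: "real_distribution \<nu>"
    unfolding \<nu>_def by (rule real_distribution_tilted_law[OF hyps])
  obtain K x0 where "dominated_subexponential \<nu> K x0"
    using dominated_subexponentialI[OF \<nu>] assms(9,10) unfolding cdf by blast
  then interpret \<nu>: dominated_subexponential \<nu> K x0 .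

  \<comment> \<open>Cutting off at 0 keeps independence and a common law and gives nonnegativity at
    every point.\<close>
  define X where "X i \<omega> = max 0 (As i \<omega>)" for i \<omega>
  have As_meas: "As i \<in> borel_measurable M" if "i \<ge> 1" for i
    using assms(12) that by (auto simp: indep_vars_def)
  have X_meas: "X i \<in> borel_measurable M" if "i \<ge> 1" for i
    using As_meas[OF that] unfolding X_def by simp
  have X_ind: "indep_vars (\<lambda>_. borel) X {1..}"
    unfolding X_def by (rule indep_vars_compose2[OF assms(12)]) simp
  have X_distr: "distr M borel (X i) = distr M borel (\<lambda>\<omega>. max 0 (A \<omega>))" if "i \<ge> 1" for i
  proof -
    have "distr M borel (X i) = distr (distr M borel (As i)) borel (max 0)"
      unfolding X_def using As_meas[OF that] by (subst distr_distr) (auto simp: comp_def)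
    also have "\<dots> = distr M borel (\<lambda>\<omega>. max 0 (A \<omega>))"
      unfolding assms(13)[OF that] by (subst distr_distr) (auto simp: comp_def)
    finally show ?thesis .
  qed
  define W where "W n \<omega> = prod_max (\<lambda>i. X i \<omega>) n 0" for n \<omega>
  have W_meas [measurable]: "W n \<in> borel_measurable M" for n
    unfolding W_def by (intro borel_measurable_prod_max X_meas) auto
  have X_nonneg: "0 \<le> X i \<omega>" for i \<omega> by (simp add: X_def)
  have W_mono: "W m \<omega> \<le> W n \<omega>" if "m \<le> n" for m n \<omega>
    unfolding W_def by (intro prod_max_mono X_nonneg that)
  have walk_max_iff: "ereal z < walk_max As \<omega> \<longleftrightarrow> (\<exists>n. exp z < W n \<omega>)" for z \<omega>
    unfolding W_def X_def by (rule less_walk_max_iff)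

  \<comment> \<open>Tails of the maximum up to time \<open>n\<close> and of the full maximum. The
    Kesten bound is an induction over \<open>n\<close>, starting from \<open>p 0 = 0\<close> on the
    nonnegative axis, and passes to \<open>q\<close> in the limit.\<close>
  define p where "p n z = prob {\<omega> \<in> space M. exp z < W n \<omega>}" for n z
  define q where "q z = prob {\<omega> \<in> space M. ereal z < walk_max As \<omega>}" for z
  have p_antimono: "p n z' \<le> p n z" if "z \<le> z'" for n z z'
    unfolding p_def using that by (intro finite_measure_mono) (auto intro: le_less_trans[of "exp z" "exp z'"])
  have p_meas [measurable]: "p n \<in> borel_measurable borel" for n
  proof -
    have "mono (\<lambda>z. - p n z)" using p_antimono by (auto simp: mono_def)
    then have "(\<lambda>z. - p n z) \<in> borel_measurable borel" by (rule borel_measurable_mono)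
    then show ?thesis by simp
  qed
  have p_lim: "(\<lambda>n. p n z) \<longlonglongrightarrow> q z" for z
  proof -
    have "(\<lambda>n. p n z) \<longlonglongrightarrow> prob (\<Union>n. {\<omega> \<in> space M. exp z < W n \<omega>})"
      unfolding p_def
    proof (rule finite_Lim_measure_incseq)
      show "incseq (\<lambda>n. {\<omega> \<in> space M. exp z < W n \<omega>})"
        by (intro monoI) (auto intro: less_le_trans[OF _ W_mono])
    qed auto
    also have "(\<Union>n. {\<omega> \<in> space M. exp z < W n \<omega>}) = {\<omega> \<in> space M. ereal z < walk_max As \<omega>}"
      by (auto simp: walk_max_iff)
    finally show ?thesis by (simp add: q_def)
  qed
  have q_meas [measurable]: "q \<in> borel_measurable borel"
    by (rule borel_measurable_LIMSEQ_real[OF p_lim]) simp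
  have p01: "0 \<le> p n z" "p n z \<le> 1" and q01: "0 \<le> q z" "q z \<le> 1" for n z
    by (auto simp: p_def q_def)
  have p0: "p 0 z = 0" if "0 \<le> z" for z
    using that by (simp add: p_def W_def)

  have shift: "prob {\<omega> \<in> space M. s < prod_max (\<lambda>i. X i \<omega>) n j} = prob {\<omega> \<in> space M. s < W n \<omega>}" for s n j
    unfolding W_def by (rule prob_less_prod_max_shift[OF X_ind X_nonneg X_distr])
  have p_Suc: "p (Suc n) x = (\<integral>\<omega>. (if 0 < A \<omega> then p n (x - ln (A \<omega>)) else 0) \<partial>M)" if "0 \<le> x" for n x
  proof -
    have "p (Suc n) x = (\<integral>a. (if 0 < a then prob {\<omega> \<in> space M. exp x / a < prod_max (\<lambda>i. X i \<omega>) n (Suc 0)} else 0)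
        \<partial>distr M borel (\<lambda>\<omega>. max 0 (A \<omega>)))"
      unfolding p_def W_def using that
      by (intro prob_less_prod_max_Suc X_ind X_nonneg X_distr) auto
    also have "\<dots> = (\<integral>a. (if 0 < a then p n (x - ln a) else 0) \<partial>distr M borel (\<lambda>\<omega>. max 0 (A \<omega>)))"
      by (intro Bochner_Integration.integral_cong refl) (auto simp: p_def shift exp_diff)
    also have "\<dots> = (\<integral>\<omega>. (if 0 < max 0 (A \<omega>) then p n (x - ln (max 0 (A \<omega>))) else 0) \<partial>M)"
      by (rule integral_distr) measurable
    also have "\<dots> = (\<integral>\<omega>. (if 0 < A \<omega> then p n (x - ln (A \<omega>)) else 0) \<partial>M)"
      by (intro Bochner_Integration.integral_cong refl) auto
    finally show ?thesis .
  qed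
  have q_eq: "q x = (\<integral>\<omega>. (if 0 < A \<omega> then q (x - ln (A \<omega>)) else 0) \<partial>M)" if "0 \<le> x" for x
  proof (rule LIMSEQ_unique)
    show "(\<lambda>n. p (Suc n) x) \<longlonglongrightarrow> q x" by (rule LIMSEQ_Suc[OF p_lim])
    show "(\<lambda>n. p (Suc n) x) \<longlonglongrightarrow> (\<integral>\<omega>. (if 0 < A \<omega> then q (x - ln (A \<omega>)) else 0) \<partial>M)"
      unfolding p_Suc[OF that]
      by (rule integral_dominated_convergence[where w="\<lambda>_. 1"]) (auto simp: p01 p_lim)
  qed
  note tilt = tilt_identity[OF hyps, folded \<theta>_def \<nu>_def]
  have exp_int: "integrable \<nu> (\<lambda>y. exp (- \<kappa> * y))"
    unfolding \<nu>_def by (rule integrable_exp_tilted_law[OF hyps])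

  define \<phi> where "\<phi> z = exp (\<kappa> * z) * q z" for z
  obtain B x1 where B: "B \<ge> 0" "x1 \<ge> x0" "\<And>n x. x \<ge> x1 \<Longrightarrow> exp (\<kappa> * x) * p n x \<le> B * \<nu>.g x"
    by (rule \<nu>.kesten_bound[where p=p, OF \<kappa> \<theta> exp_int p01 p_meas p0]) (simp_all add: tilt p_Suc)
  have \<phi>_bound: "\<phi> x \<le> B * \<nu>.g x" if "x \<ge> x1" for x
    unfolding \<phi>_def
    by (rule LIMSEQ_le_const2[OF tendsto_mult_left[OF p_lim]]) (use B(3)[OF that] in auto)
  have \<phi>_int: "integrable \<nu> (\<lambda>y. \<phi> (x - y))" for x
  proof (rule Bochner_Integration.integrable_bound)
    show "integrable \<nu> (\<lambda>y. exp (\<kappa> * x) * exp (- \<kappa> * y))"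
      using exp_int by simp
    show "AE y in \<nu>. norm (\<phi> (x - y)) \<le> norm (exp (\<kappa> * x) * exp (- \<kappa> * y))"
      using q01 mult_left_mono[OF q01(2), of "exp (\<kappa> * (x - y))" for y]
      by (intro AE_I2) (auto simp: \<phi>_def abs_mult algebra_simps simp flip: exp_add)
  qed (simp add: \<phi>_def)

  \<comment> \<open>The maximum cut off at \<open>h\<close> is a bounded real variable, even where
    the maximum is infinite, and below \<open>h\<close> it has the same tail as the maximum.\<close>
  define Z where "Z h \<omega> = real_of_ereal (min (ereal h) (walk_max As \<omega>))" for h \<omega>
  have walk_nonneg: "0 \<le> walk_max As \<omega>" for \<omega> by (simp add: walk_max_def)
  have Z_less: "z < Z h \<omega> \<longleftrightarrow> ereal z < walk_max As \<omega>" if "0 \<le> h" "z < h" for h z \<omega>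
    using that walk_nonneg[of \<omega>] unfolding Z_def by (cases "walk_max As \<omega>") (auto simp: min_def)
  have Z_bounds: "0 \<le> Z h \<omega> \<and> Z h \<omega> \<le> h" if "0 \<le> h" for h \<omega>
    using that walk_nonneg[of \<omega>] unfolding Z_def by (cases "walk_max As \<omega>") (auto simp: min_def)
  have Z_meas: "Z h \<in> borel_measurable M" if "0 \<le> h" for h
  proof (rule borel_measurable_iff_greater[THEN iffD2], intro allI)
    fix z
    show "{\<omega> \<in> space M. z < Z h \<omega>} \<in> sets M"
    proof (cases "z < h")
      case True
      then show ?thesis by (simp add: Z_less[OF that] walk_max_iff)
    next
      case False
      then have "\<not> z < Z h \<omega>" for \<omega> using Z_bounds[OF that, of \<omega>] by linarith
      then show ?thesis by simp
    qed
  qed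
  obtain c where c: "c > 0" "((\<lambda>x. \<phi> x / \<nu>.g x) \<longlongrightarrow> c) at_top"
  proof (rule \<nu>.renewal_limit[OF \<theta> _ \<phi>_int _ B(1,2) \<phi>_bound])
    show "0 \<le> \<phi> x" for x by (simp add: \<phi>_def q01)
    show "\<phi> x = \<theta> * (\<integral>y. \<phi> (x - y) \<partial>\<nu>)" if "0 \<le> x" for x
      unfolding \<phi>_def by (subst tilt) (simp_all flip: q_eq[OF that])
    \<comment> \<open>This limit is the integral of \<open>\<phi>\<close> over
      \<open>(-\<infinity>, h)\<close>.\<close>
    show "((\<lambda>x. \<nu>.high \<phi> h x / \<nu>.g x) \<longlongrightarrow> expectation (\<lambda>\<omega>. exp (\<kappa> * Z h \<omega>)) / \<kappa>) at_top" if "0 \<le> h" for h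
      using Z_less[OF that]
      by (intro \<nu>.high_limit Z_meas Z_bounds \<kappa> that prob_space_axioms) (simp add: \<phi>_def q_def)
    \<comment> \<open>At \<open>h = 0\<close> the limit is therefore \<open>1 / \<kappa>\<close>,
      which makes the final constant positive.\<close>
    have "Z 0 \<omega> = 0" for \<omega> using Z_bounds[of 0 \<omega>] by simp
    then show "expectation (\<lambda>\<omega>. exp (\<kappa> * Z 0 \<omega>)) / \<kappa> > 0"
      using \<kappa> by (simp add: prob_space)
  qed
  have "q \<sim>[at_top] (\<lambda>x. c * \<nu>.g x * exp (- \<kappa> * x))"
  proof (rule asymp_equivI')
    have "((\<lambda>x. \<phi> x / \<nu>.g x / c) \<longlongrightarrow> c / c) at_top"
      using c by (intro tendsto_divide) auto
    moreover have "\<phi> x / \<nu>.g x / c = q x / (c * \<nu>.g x * exp (- \<kappa> * x))" for x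
      by (simp add: \<phi>_def exp_minus field_simps)
    ultimately show "((\<lambda>x. q x / (c * \<nu>.g x * exp (- \<kappa> * x))) \<longlongrightarrow> 1) at_top"
      using c by simp
  qed
  then show ?thesis
    using c(1) unfolding q_def cdf incr_def by blast
qed

end
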